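(* Let $n,m\in\mathbb{R}$. There exists $\epsilon_c>0$ such that for any $0<\epsilon<\epsilon_c$ there exists $\delta>0$ such that the following holds. If $\|\phi_0-1\|_{H^1}\le\delta$, then any solution $\phi$ of $$\phi_t+(\phi^n)_z-(\phi^n(\phi^{-m}\phi_t)_z)_z=0$$ with initial condition $\phi(\cdot,0)=\phi_0$ and $\phi-1\in C^1([0,T);H^k(\mathbb{R}))$, where $k\ge1$ is an integer and $0<T\le\infty$, satisfies $$\|\phi(\cdot,t)-1\|_{H^1}\le\epsilon\qquad\text{for all } t<T.$$
   Context: $H^k=W^{k,2}(\mathbb{R})$. A solution on $[0,T)$ with data $\phi_0$ is a function $\phi>0$ with $\phi-1\in C^1([0,T);H^k(\mathbb{R}))$ such that $$\phi(\cdot,t)=\phi_0+\int_0^t\phi(\cdot,s)^m u(\cdot,s)\,ds,$$ where for each $s$, $u(\cdot,s)\in H^1(\mathbb{R})$ is the unique weak solution of $-(\phi(\cdot,s)^n u_z)_z+\phi(\cdot,s)^m u=-(\phi(\cdot,s)^n)_z$. *)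

theory Defs
  imports "HOL-Analysis.Analysis"
begin

text \<open>
  Sobolev spaces on the real line. Elements are represented by functions, not by
  equivalence classes modulo null sets, so every notion in this part is invariant under
  changing its arguments (within the Borel functions) on a null set.
\<close>

definition test_function :: "(real \<Rightarrow> real) \<Rightarrow> bool" where
  "test_function \<psi> \<longleftrightarrow>
     (\<forall>j. (deriv ^^ j) \<psi> differentiable_on UNIV) \<and> compact (closure {x. \<psi> x \<noteq> 0})"

definition locally_integrable :: "(real \<Rightarrow> real) \<Rightarrow> bool" where
  "locally_integrable f \<longleftrightarrow> (\<forall>a b. set_integrable lborel {a..b} f)"

definition square_integrable :: "(real \<Rightarrow> real) \<Rightarrow> bool" where
  "square_integrable f \<longleftrightarrow>
     f \<in> borel_measurable lborel \<and> integrable lborel (\<lambda>x. (f x)\<^sup>2)"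

definition has_weak_derivative :: "nat \<Rightarrow> (real \<Rightarrow> real) \<Rightarrow> (real \<Rightarrow> real) \<Rightarrow> bool" where
  "has_weak_derivative j f g \<longleftrightarrow>
     locally_integrable f \<and> locally_integrable g \<and>
     (\<forall>\<psi>. test_function \<psi> \<longrightarrow>
        (LINT x|lborel. f x * (deriv ^^ j) \<psi> x) = (- 1) ^ j * (LINT x|lborel. g x * \<psi> x))"

text \<open>
  The weak derivative is determined only up to a null set; this picks a representative
  and is meaningful only where a weak derivative exists.
\<close>

definition weak_derivative :: "nat \<Rightarrow> (real \<Rightarrow> real) \<Rightarrow> real \<Rightarrow> real" where
  "weak_derivative j f = (SOME g. has_weak_derivative j f g)"

definition sobolev :: "nat \<Rightarrow> (real \<Rightarrow> real) set" where
  "sobolev k = {f. square_integrable f \<and>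
     (\<forall>j\<le>k. \<exists>g. square_integrable g \<and> has_weak_derivative j f g)}"

text \<open>The value of the norm is meaningful only on \<^term>\<open>sobolev k\<close>.\<close>

definition sobolev_norm :: "nat \<Rightarrow> (real \<Rightarrow> real) \<Rightarrow> real" where
  "sobolev_norm k f = sqrt (\<Sum>j\<le>k. LINT x|lborel. (weak_derivative j f x)\<^sup>2)"

text \<open>
  Curves \<open>w\<close> in \<open>H\<^sup>k\<close> have the time as first argument. Since \<open>H\<^sup>k\<close> is a set
  of functions and not a type, continuity and differentiability (one-sided at end points
  contained in the interval \<open>I\<close>) are spelled out with the norm.
\<close>

definition sobolev_continuous_on :: "nat \<Rightarrow> real set \<Rightarrow> (real \<Rightarrow> real \<Rightarrow> real) \<Rightarrow> bool" where
  "sobolev_continuous_on k I w \<longleftrightarrow>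
     (\<forall>t\<in>I. w t \<in> sobolev k) \<and>
     (\<forall>t\<in>I. ((\<lambda>s. sobolev_norm k (\<lambda>z. w s z - w t z)) \<longlongrightarrow> 0) (at t within I))"

definition sobolev_C1_on :: "nat \<Rightarrow> real set \<Rightarrow> (real \<Rightarrow> real \<Rightarrow> real) \<Rightarrow> bool" where
  "sobolev_C1_on k I w \<longleftrightarrow>
     sobolev_continuous_on k I w \<and>
     (\<exists>w'. sobolev_continuous_on k I w' \<and>
        (\<forall>t\<in>I. ((\<lambda>s. sobolev_norm k (\<lambda>z. (w s z - w t z) / (s - t) - w' t z)) \<longlongrightarrow> 0)
                 (at t within I)))"

text \<open>
  Weak formulation, with test functions in \<open>H\<^sup>1\<close>, of
  \[ -(f^n u_z)_z + f^m u = -(f^n)_z . \]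
  It is used for continuous \<open>f > 0\<close> with \<open>f - 1 \<in> H\<^sup>1\<close>; then \<open>f\<close> is bounded and bounded
  away from \<open>0\<close>, so that all integrals converge, and the weak solution in \<open>H\<^sup>1\<close> exists and
  is unique (Lax--Milgram).
\<close>

definition elliptic_weak_solution ::
    "real \<Rightarrow> real \<Rightarrow> (real \<Rightarrow> real) \<Rightarrow> (real \<Rightarrow> real) \<Rightarrow> bool" where
  "elliptic_weak_solution n m f u \<longleftrightarrow>
     u \<in> sobolev 1 \<and>
     (\<forall>\<psi>\<in>sobolev 1.
        (LINT z|lborel. f z powr n * weak_derivative 1 u z * weak_derivative 1 \<psi> z
                          + f z powr m * u z * \<psi> z)
        = - (LINT z|lborel. weak_derivative 1 (\<lambda>y. f y powr n) z * \<psi> z))"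

text \<open>
  A solution on \<open>[0,T)\<close> of
  \[ \phi_t + (\phi^n)_z - (\phi^n (\phi^{-m} \phi_t)_z)_z = 0, \qquad \phi(\cdot,0) = \phi_0, \]
  in integrated form with \<open>u = \<phi>\<^sup>-\<^sup>m \<phi>\<^sub>t\<close>. The functions \<open>\<phi> t\<close> and \<open>u t\<close> are the continuous
  representatives of their classes, which gives a meaning to positivity and to the time
  integral pointwise in space. At \<open>t = 0\<close> the integral equation is the initial condition.
\<close>

definition magma_solution ::
    "real \<Rightarrow> real \<Rightarrow> nat \<Rightarrow> ereal \<Rightarrow> (real \<Rightarrow> real) \<Rightarrow> (real \<Rightarrow> real \<Rightarrow> real) \<Rightarrow> bool" where
  "magma_solution n m k T \<phi>\<^sub>0 \<phi> \<longleftrightarrow>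
     (let I = {t. 0 \<le> t \<and> ereal t < T} in
       (\<forall>t\<in>I. continuous_on UNIV (\<phi> t) \<and> (\<forall>z. \<phi> t z > 0)) \<and>
       sobolev_C1_on k I (\<lambda>t z. \<phi> t z - 1) \<and>
       (\<exists>u. (\<forall>s\<in>I. continuous_on UNIV (u s) \<and> elliptic_weak_solution n m (\<phi> s) (u s)) \<and>
            (\<forall>t\<in>I. \<forall>z. ((\<lambda>s. \<phi> s z powr m * u s z) has_integral (\<phi> t z - \<phi>\<^sub>0 z)) {0..t})))"

end

theory Submission
  imports Defs
begin

text \<open>
  With \<open>u = \<phi>\<^sup>-\<^sup>m \<phi>\<^sub>t\<close> one has \<open>(\<phi>\<^sup>-\<^sup>m \<phi>\<^sub>z)\<^sub>t = u\<^sub>z\<close>, and testing the equation with \<open>F'(\<phi>)\<close>, where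
  \<open>F'' = \<phi>\<^sup>-\<^sup>m\<^sup>-\<^sup>n\<close> and \<open>F(1) = F'(1) = 0\<close>, shows that the energy
  \<open>\<integral> \<phi>\<^sup>-\<^sup>2\<^sup>m \<phi>\<^sub>z\<^sup>2 / 2 + F(\<phi>)\<close> is conserved. As long as \<open>\<bar>\<phi> - 1\<bar> \<le> 1/2\<close> the energy is comparable to the
  square of the \<open>H\<^sup>1\<close> norm of \<open>\<phi> - 1\<close>, and this norm controls the supremum of \<open>\<bar>\<phi> - 1\<bar>\<close>; so at the
  first time at which the norm reaches \<open>\<epsilon>\<close> the energy would exceed its initial value.
\<close>

section \<open>Smooth cutoff functions and the fundamental lemma\<close>

text \<open>For \<psi> = F'(\<phi>) one has \<psi>_z = \<phi>^(-m-n) \<phi>_z, so the term \<phi>^n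
  u_z \<psi>_z of the weak equation is \<phi>^(-m) \<phi>_z u_z, the time derivative of the gradient
  part of the energy density. The term \<phi>^m u \<psi> is F'(\<phi>) \<phi>_t, that of the
  potential part, and (\<phi>^n)_z F'(\<phi>) on the right is a perfect z-derivative. Only first
  derivatives in z occur, which is all that k = 1 offers; hence the calculus of continuous functions
  with locally integrable derivatives. The obstacle in time is that u enters through an integral
  equation holding separately for each z, so \<phi>_t = \<phi>^m u is available for almost every
  time only. The C^1 hypothesis makes the energy differentiable at every time, and a derivative
  vanishing almost everywhere integrates to zero. The threshold for \<epsilon> is 1/4 for all n and
  m, because the supremum of |\<phi> - 1| is at most twice the H^1 norm.\<close>

definition flat :: "real poly \<Rightarrow> real \<Rightarrow> real" where
  "flat p x = (if x > 0 then poly p (1 / x) * exp (- (1 / x)) else 0)"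

lemma tendsto_poly_div_exp: "((\<lambda>x::real. poly p x / exp x) \<longlongrightarrow> 0) at_top"
proof -
  have "((\<lambda>x::real. \<Sum>i\<le>degree p. coeff p i * (x ^ i / exp x)) \<longlongrightarrow> (\<Sum>i\<le>degree p. coeff p i * 0)) at_top"
    by (intro tendsto_intros tendsto_power_div_exp_0)
  then show ?thesis
    by (simp add: poly_altdef sum_divide_distrib)
qed

text \<open>With y = 1/x the derivative of p(y) exp(-y) is y^2 (p - p')(y) exp(-y), hence the factor
  \<open>[:0, 0, 1:]\<close>: the functions \<open>flat p\<close> are closed under differentiation.
  At 0 the right difference quotient is y p(y) / exp y with y tending to infinity.\<close>

lemma has_real_derivative_flat:
  "(flat p has_real_derivative flat ([:0, 0, 1:] * (p - pderiv p)) x) (at x)"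
proof (cases x "0::real" rule: linorder_cases)
  case less
  have "((\<lambda>x. 0) has_real_derivative 0) (at x)" by simp
  moreover have "open {..<0::real}" by simp
  ultimately have "(flat p has_real_derivative 0) (at x)"
    by (rule has_field_derivative_transform_within_open) (use less in \<open>auto simp: flat_def\<close>)
  then show ?thesis using less by (simp add: flat_def)
next
  case greater
  have "((\<lambda>x. poly p (1 / x) * exp (- (1 / x))) has_real_derivative
      flat ([:0, 0, 1:] * (p - pderiv p)) x) (at x)"
    using greater
    by (auto intro!: derivative_eq_intros DERIV_chain'[OF _ poly_DERIV] simp: flat_def field_simps power2_eq_square)
  moreover have "open {0::real<..}" by simp
  ultimately show ?thesis
    by (rule has_field_derivative_transform_within_open) (use greater in \<open>auto simp: flat_def\<close>)
next
  case equal
  have "((\<lambda>y. flat p y / y) \<longlongrightarrow> 0) (at_right 0)"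
    unfolding filterlim_at_right_to_top
  proof (rule Lim_transform_eventually)
    show "((\<lambda>x. poly ([:0, 1:] * p) x / exp x) \<longlongrightarrow> 0) at_top"
      by (rule tendsto_poly_div_exp)
    show "\<forall>\<^sub>F x in at_top. poly ([:0, 1:] * p) x / exp x = flat p (inverse x) / inverse x"
      using eventually_gt_at_top[of 0]
      by eventually_elim (auto simp: flat_def field_simps exp_minus)
  qed
  moreover have "((\<lambda>y. flat p y / y) \<longlongrightarrow> 0) (at_left 0)"
    by (rule tendsto_eventually) (auto simp: eventually_at_filter flat_def)
  ultimately have "((\<lambda>y. flat p y / y) \<longlongrightarrow> 0) (at 0)"
    by (simp add: filterlim_split_at)
  then show ?thesis
    using equal by (simp add: has_field_derivative_def has_derivative_at DERIV_def flat_def flip: has_field_derivative_def)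
qed

text \<open>An algebra of functions that contains the derivatives of its members, so that iterated
  derivatives are handled by a plain induction without any formula for them.\<close>

inductive_set cutoffs :: "(real \<Rightarrow> real) set" where
  const: "(\<lambda>x. c) \<in> cutoffs"
| flat: "(\<lambda>x. flat p (c * x + d)) \<in> cutoffs"
| add: "f \<in> cutoffs \<Longrightarrow> g \<in> cutoffs \<Longrightarrow> (\<lambda>x. f x + g x) \<in> cutoffs"
| mult: "f \<in> cutoffs \<Longrightarrow> g \<in> cutoffs \<Longrightarrow> (\<lambda>x. f x * g x) \<in> cutoffs"

lemma cutoffs_derivative:
  "f \<in> cutoffs \<Longrightarrow> \<exists>f'\<in>cutoffs. \<forall>x. (f has_real_derivative f' x) (at x)"
proof (induction rule: cutoffs.induct)
  case (const c)
  show ?case by (rule bexI[OF _ cutoffs.const[of 0]]) auto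
next
  case (flat p c d)
  have "((\<lambda>x. flat p (c * x + d)) has_real_derivative flat ([:0, 0, 1:] * (p - pderiv p)) (c * x + d) * c) (at x)" for x
    by (rule DERIV_chain'[OF _ has_real_derivative_flat]) (auto intro!: derivative_eq_intros)
  then show ?case
    by (intro bexI[OF _ cutoffs.mult[OF cutoffs.flat cutoffs.const]]) auto
next
  case (add f g)
  then obtain f' g' where "f' \<in> cutoffs" "g' \<in> cutoffs"
    "\<forall>x. (f has_real_derivative f' x) (at x)" "\<forall>x. (g has_real_derivative g' x) (at x)" by blast
  then show ?case
    by (intro bexI[of _ "\<lambda>x. f' x + g' x"]) (auto intro!: cutoffs.add derivative_intros)
next
  case (mult f g)
  then obtain f' g' where "f' \<in> cutoffs" "g' \<in> cutoffs"
    "\<forall>x. (f has_real_derivative f' x) (at x)" "\<forall>x. (g has_real_derivative g' x) (at x)" by blast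
  with mult show ?case
    by (intro bexI[of _ "\<lambda>x. f' x * g x + g' x * f x"]) (auto intro!: cutoffs.add cutoffs.mult derivative_intros)
qed

lemma higher_deriv_cutoffs:
  assumes "f \<in> cutoffs"
  shows "(deriv ^^ j) f \<in> cutoffs"
proof (induction j)
  case (Suc j)
  obtain f' where f': "f' \<in> cutoffs" "\<forall>x. ((deriv ^^ j) f has_real_derivative f' x) (at x)"
    using cutoffs_derivative[OF Suc] by blast
  then have "deriv ((deriv ^^ j) f) = f'"
    by (auto intro!: DERIV_imp_deriv)
  with f' show ?case by simp
qed (use assms in simp)

lemma differentiable_cutoffs: "f \<in> cutoffs \<Longrightarrow> (deriv ^^ j) f differentiable_on UNIV"
  using cutoffs_derivative[OF higher_deriv_cutoffs, of f j]
  by (metis differentiable_on_def field_differentiable_def field_differentiable_imp_differentiable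
      differentiable_at_withinI)

text \<open>On (a, b) this is exp(-\<delta>/(x - a)) exp(-\<delta>/(b - x)). The parameter \<delta>
  sets the steepness while the interval stays fixed, so \<delta> tending to 0 gives the indicator of
  the open interval.\<close>

definition bump :: "real \<Rightarrow> real \<Rightarrow> real \<Rightarrow> real \<Rightarrow> real" where
  "bump \<delta> a b x = flat 1 ((x - a) / \<delta>) * flat 1 ((b - x) / \<delta>)"

lemma bump_support: "\<delta> > 0 \<Longrightarrow> x \<notin> {a<..<b} \<Longrightarrow> bump \<delta> a b x = 0"
  by (auto simp: bump_def flat_def field_simps)

lemma bump_bounds: "0 \<le> bump \<delta> a b x" "bump \<delta> a b x \<le> 1"
proof -
  have "0 \<le> flat 1 y" "flat 1 y \<le> 1" for y by (auto simp: flat_def)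
  then show "0 \<le> bump \<delta> a b x" "bump \<delta> a b x \<le> 1"
    by (auto simp: bump_def intro: mult_le_one)
qed

lemma bump_pos: "\<delta> > 0 \<Longrightarrow> x \<in> {a<..<b} \<Longrightarrow> bump \<delta> a b x > 0"
  by (auto simp: bump_def flat_def)

lemma compact_closure_support:
  fixes \<psi> :: "real \<Rightarrow> real"
  assumes "\<And>x. x \<notin> {a..b} \<Longrightarrow> \<psi> x = 0"
  shows "compact (closure {x. \<psi> x \<noteq> 0})"
proof -
  have "{x. \<psi> x \<noteq> 0} \<subseteq> {a..b}" using assms by blast
  then show ?thesis
    by (meson bounded_closed_interval bounded_subset compact_closure)
qed

lemma test_function_bump:
  assumes "\<delta> > 0"
  shows "test_function (bump \<delta> a b)"
proof -
  have "bump \<delta> a b = (\<lambda>x. flat 1 ((1/\<delta>) * x + (-a/\<delta>)) * flat 1 ((-1/\<delta>) * x + b/\<delta>))"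
    by (auto simp: bump_def field_simps diff_divide_distrib fun_eq_iff)
  also have "\<dots> \<in> cutoffs" by (intro cutoffs.intros)
  finally have "\<forall>j. (deriv ^^ j) (bump \<delta> a b) differentiable_on UNIV"
    using differentiable_cutoffs by blast
  then show ?thesis
    unfolding test_function_def
    using compact_closure_support[of a b "bump \<delta> a b"] bump_support[OF assms] by force
qed

lemma bump_tendsto_indicator:
  "(\<lambda>i. bump (1 / Suc i) a b x) \<longlonglongrightarrow> indicator {a<..<b} x"
proof (cases "x \<in> {a<..<b}")
  case True
  have "(\<lambda>i. exp (- ((1 / Suc i) / (x - a))) * exp (- ((1 / Suc i) / (b - x)))) \<longlonglongrightarrow> exp (- (0 / (x - a))) * exp (- (0 / (b - x)))"
    using True by (intro tendsto_intros LIMSEQ_Suc[OF lim_1_over_n]) auto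
  moreover have "bump (1 / Suc i) a b x = exp (- ((1 / Suc i) / (x - a))) * exp (- ((1 / Suc i) / (b - x)))" for i
    using True by (simp add: bump_def flat_def mult.commute)
  ultimately show ?thesis using True by simp
next
  case False
  then have "bump (1 / Suc i) a b x = 0" for i
    by (intro bump_support) auto
  with False show ?thesis by simp
qed

section \<open>Local integrability\<close>

lemma locally_integrable_measurable:
  assumes "locally_integrable f"
  shows "f \<in> borel_measurable borel"
proof (rule borel_measurable_LIMSEQ_real)
  fix i :: nat
  have "set_integrable lborel {-real i..real i} f"
    using assms by (simp add: locally_integrable_def)
  then show "(\<lambda>x. indicator {-real i..real i} x * f x) \<in> borel_measurable borel"
    unfolding set_integrable_def using borel_measurable_integrable by fastforce
next
  fix x :: real
  have "\<forall>\<^sub>F i in sequentially. indicator {-real i..real i} x * f x = f x"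
  proof -
    obtain k :: nat where "\<bar>x\<bar> < real k" using reals_Archimedean2 by blast
    then show ?thesis
      by (intro eventually_sequentiallyI[of k]) (auto simp: indicator_def)
  qed
  then show "(\<lambda>i. indicator {-real i..real i} x * f x) \<longlonglongrightarrow> f x"
    by (rule tendsto_eventually)
qed

lemma locally_integrable_set:
  "locally_integrable f \<Longrightarrow> set_integrable lborel {a..b} f"
  by (simp add: locally_integrable_def)

lemma locally_integrable_has_integral:
  "locally_integrable f \<Longrightarrow> (f has_integral (LINT x:{a..b}|lborel. f x)) {a..b}"
  using set_borel_integral_eq_integral[OF locally_integrable_set]
  by (metis integrable_integral)

lemma locally_integrable_mult_bounded:
  assumes "locally_integrable f" "h \<in> borel_measurable borel"
    "\<And>a b. \<exists>C. \<forall>x\<in>{a..b}. \<bar>h x\<bar> \<le> C"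
  shows "locally_integrable (\<lambda>x. h x * f x)"
  unfolding locally_integrable_def
proof (intro allI)
  fix a b
  obtain C where C: "\<And>x. x \<in> {a..b} \<Longrightarrow> \<bar>h x\<bar> \<le> C" using assms(3) by blast
  have [measurable]: "f \<in> borel_measurable borel" "h \<in> borel_measurable borel"
    using assms locally_integrable_measurable by auto
  have "set_integrable lborel {a..b} (\<lambda>x. C * f x)"
    using assms(1) by (auto intro: locally_integrable_set)
  then show "set_integrable lborel {a..b} (\<lambda>x. h x * f x)"
  proof (rule set_integrable_bound)
    show "set_borel_measurable lborel {a..b} (\<lambda>x. h x * f x)"
      unfolding set_borel_measurable_def by measurable
    show "AE x in lborel. x \<in> {a..b} \<longrightarrow> norm (h x * f x) \<le> norm (C * f x)"
    proof (intro AE_I2 impI)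
      fix x assume "x \<in> {a..b}"
      then have "\<bar>h x\<bar> \<le> \<bar>C\<bar>" using C by fastforce
      then show "norm (h x * f x) \<le> norm (C * f x)"
        by (simp add: abs_mult mult_right_mono)
    qed
  qed
qed

lemma locally_integrable_mult_continuous:
  assumes "locally_integrable f" "continuous_on UNIV h"
  shows "locally_integrable (\<lambda>x. h x * f x)"
proof (rule locally_integrable_mult_bounded[OF assms(1)])
  show "h \<in> borel_measurable borel" using assms by (simp add: borel_measurable_continuous_onI)
  fix a b
  have "compact (h ` {a..b})"
    using assms by (intro compact_continuous_image) (auto intro: continuous_on_subset)
  then show "\<exists>C. \<forall>x\<in>{a..b}. \<bar>h x\<bar> \<le> C"
    by (metis bounded_iff compact_imp_bounded imageI real_norm_def)
qed

lemma locally_integrable_continuous: "continuous_on UNIV h \<Longrightarrow> locally_integrable h"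
  unfolding locally_integrable_def
  by (auto intro: borel_integrable_atLeastAtMost' continuous_on_subset)

lemma locally_integrable_add:
  "locally_integrable f \<Longrightarrow> locally_integrable g \<Longrightarrow> locally_integrable (\<lambda>x. f x + g x)"
  by (auto simp: locally_integrable_def)

lemma locally_integrable_diff:
  "locally_integrable f \<Longrightarrow> locally_integrable g \<Longrightarrow> locally_integrable (\<lambda>x. f x - g x)"
  by (auto simp: locally_integrable_def)

lemma locally_integrable_cmult:
  "locally_integrable f \<Longrightarrow> locally_integrable (\<lambda>x. c * f x)"
  by (auto simp: locally_integrable_def)

lemma locally_integrable_abs:
  "locally_integrable f \<Longrightarrow> locally_integrable (\<lambda>x. \<bar>f x\<bar>)"
  by (auto simp: locally_integrable_def intro: set_integrable_abs)

lemma locally_integrable_compact_support: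
  assumes "locally_integrable f" "\<And>x. x \<notin> {a..b} \<Longrightarrow> f x = 0"
  shows "integrable lborel f" "(LINT x|lborel. f x) = (LINT x:{a..b}|lborel. f x)"
proof -
  have eq: "(\<lambda>x. indicator {a..b} x *\<^sub>R f x) = f"
    using assms(2) by (auto simp: fun_eq_iff indicator_def)
  show "integrable lborel f"
    using locally_integrable_set[OF assms(1), of a b] by (simp only: set_integrable_def eq)
  show "(LINT x|lborel. f x) = (LINT x:{a..b}|lborel. f x)"
    by (simp only: set_lebesgue_integral_def eq)
qed

text \<open>Averages over [x, x + h] converge to f x outside a null set, which holds for gauge
  integrals without absolute integrability. This generality serves the time integral in the notion
  of solution, which is such an integral.\<close>

lemma negligible_if_integrals_zero:
  fixes f :: "real \<Rightarrow> real"
  assumes "\<And>x y. x \<le> y \<Longrightarrow> (f has_integral 0) {x..y}"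
  shows "negligible {x. f x \<noteq> 0}"
proof -
  have int: "(f has_integral 0) {x..y}" for x y
    using assms[of x y] by (cases "x \<le> y") auto
  then have "f integrable_on cbox x y" for x y by auto
  then obtain N where N: "negligible N" "\<And>x e. \<lbrakk>x \<notin> N; 0 < e\<rbrakk> \<Longrightarrow>
      \<exists>d>0. \<forall>h. 0 < h \<and> h < d \<longrightarrow> norm (integral (cbox x (x + h *\<^sub>R One)) f /\<^sub>R h ^ DIM(real) - f x) < e"
    using integrable_ccontinuous_explicit[of f] by blast
  have "x \<in> N" if fx: "f x \<noteq> 0" for x
  proof (rule ccontr)
    assume "x \<notin> N"
    then obtain d where "d > 0" and
      d: "\<And>h. 0 < h \<and> h < d \<Longrightarrow> norm (integral (cbox x (x + h *\<^sub>R One)) f /\<^sub>R h ^ DIM(real) - f x) < \<bar>f x\<bar>"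
      using N(2)[of x "\<bar>f x\<bar>"] fx by (metis zero_less_abs_iff)
    have "integral (cbox x (x + (d/2) *\<^sub>R One)) f = 0"
      using int by (auto intro: integral_unique)
    with d[of "d/2"] \<open>d > 0\<close> show False by simp
  qed
  then show ?thesis
    by (intro negligible_subset[OF N(1)]) auto
qed

lemma AE_lborel_if_negligible:
  assumes "negligible {x. \<not> P x}" "{x. P x} \<in> sets borel"
  shows "AE x in lborel. P x"
proof -
  have "AE x in lebesgue. P x"
    using assms(1) by (simp add: negligible_iff_null_sets AE_iff_null_sets eventually_ae_filter) (metis (mono_tags, lifting) mem_Collect_eq subsetI)
  then show ?thesis
    by (simp add: AE_completion_iff)
qed

lemma AE_zero_if_integrals_zero:
  assumes f: "locally_integrable f" and "\<And>x y. x \<le> y \<Longrightarrow> (f has_integral 0) {x..y}"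
  shows "AE x in lborel. f x = 0"
proof (rule AE_lborel_if_negligible)
  show "negligible {x. f x \<noteq> 0}"
    using assms by (intro negligible_if_integrals_zero)
  show "{x. f x = 0} \<in> sets borel"
    using locally_integrable_measurable[OF f] by measurable
qed

text \<open>The bumps on (a, b) are dominated by the indicator of the interval and converge to it,
  so the integral of h over every interval is a limit of zeros.\<close>

lemma fundamental_lemma:
  assumes h: "locally_integrable h"
    and test: "\<And>\<psi>. test_function \<psi> \<Longrightarrow> (LINT x|lborel. h x * \<psi> x) = 0"
  shows "AE x in lborel. h x = 0"
proof (rule AE_zero_if_integrals_zero[OF h])
  fix a b :: real assume "a \<le> b"
  have [measurable]: "h \<in> borel_measurable borel"
    by (rule locally_integrable_measurable[OF h])
  have meas: "bump (1 / Suc i) a b \<in> borel_measurable borel" for i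
  proof -
    have "bump (1 / Suc i) a b differentiable_on UNIV"
      using test_function_bump[of "1 / Suc i" a b] unfolding test_function_def
      by (metis funpow_0 of_nat_0_less_iff zero_less_Suc zero_less_divide_1_iff)
    then show ?thesis
      by (intro borel_measurable_continuous_onI differentiable_imp_continuous_on)
  qed
  have "(\<lambda>i. LINT x|lborel. h x * bump (1 / Suc i) a b x) \<longlonglongrightarrow> (LINT x|lborel. h x * indicator {a<..<b} x)"
  proof (rule integral_dominated_convergence)
    show "integrable lborel (\<lambda>x. \<bar>indicator {a..b} x * h x\<bar>)"
      using locally_integrable_set[OF h, of a b] by (simp add: set_integrable_def)
    show "AE x in lborel. (\<lambda>i. h x * bump (1 / Suc i) a b x) \<longlonglongrightarrow> h x * indicator {a<..<b} x"
      by (intro AE_I2 tendsto_intros bump_tendsto_indicator)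
    show "AE x in lborel. norm (h x * bump (1 / Suc i) a b x) \<le> \<bar>indicator {a..b} x * h x\<bar>" for i
    proof (rule AE_I2)
      fix x
      show "norm (h x * bump (1 / Suc i) a b x) \<le> \<bar>indicator {a..b} x * h x\<bar>"
      proof (cases "x \<in> {a<..<b}")
        case True
        with bump_bounds[of "1 / Suc i" a b x] show ?thesis
          by (auto simp: abs_mult intro: mult_left_le)
      next
        case False
        then have "bump (1 / Suc i) a b x = 0" by (intro bump_support) auto
        then show ?thesis by simp
      qed
    qed
  qed (use meas in measurable)
  then have "(LINT x|lborel. h x * indicator {a<..<b} x) = 0"
    using test[OF test_function_bump] by (simp add: LIMSEQ_const_iff)
  also have "(LINT x|lborel. h x * indicator {a<..<b} x) = (LINT x:{a..b}|lborel. h x)"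
    unfolding set_lebesgue_integral_def
  proof (rule integral_cong_AE)
    have "AE x in lborel. x \<noteq> a" "AE x in lborel. x \<noteq> b"
      by (auto intro: AE_lborel_singleton)
    then show "AE x in lborel. h x * indicator {a<..<b} x = indicator {a..b} x *\<^sub>R h x"
      by eventually_elim (auto simp: indicator_def)
  qed measurable
  finally show "(h has_integral 0) {a..b}"
    using locally_integrable_has_integral[OF h] by metis
qed

section \<open>Primitives of locally integrable functions and weak derivatives\<close>

text \<open>Local absolute continuity of f with derivative g, phrased by increments: f is a
  continuous function and meant pointwise, whereas g matters only up to null sets.\<close>

definition is_primitive :: "(real \<Rightarrow> real) \<Rightarrow> (real \<Rightarrow> real) \<Rightarrow> bool" where
  "is_primitive f g \<longleftrightarrow>
     locally_integrable g \<and> (\<forall>x y. x \<le> y \<longrightarrow> (g has_integral (f y - f x)) {x..y})"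

lemma is_primitive_has_integral:
  "is_primitive f g \<Longrightarrow> x \<le> y \<Longrightarrow> (g has_integral (f y - f x)) {x..y}"
  by (simp add: is_primitive_def)

lemma is_primitive_locally_integrable: "is_primitive f g \<Longrightarrow> locally_integrable g"
  by (simp add: is_primitive_def)

lemma is_primitive_on_interval:
  assumes "is_primitive f g" "y \<in> {x - 1..x + 1}"
  shows "f y = f (x - 1) + integral {x - 1..y} g"
  using integral_unique[OF is_primitive_has_integral[OF assms(1), of "x - 1" y]] assms(2) by simp

lemma is_primitive_continuous:
  assumes "is_primitive f g"
  shows "continuous_on UNIV f"
proof (rule continuous_at_imp_continuous_on, intro ballI)
  fix x
  have "g integrable_on {x - 1..x + 1}"
    using is_primitive_has_integral[OF assms, of "x - 1" "x + 1"] by auto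
  then have "continuous_on {x - 1..x + 1} (\<lambda>y. f (x - 1) + integral {x - 1..y} g)"
    by (intro continuous_intros indefinite_integral_continuous_1)
  then have "continuous_on {x - 1..x + 1} f"
    by (rule continuous_on_eq) (simp add: is_primitive_on_interval[OF assms])
  then show "isCont f x"
    by (rule continuous_on_interior) simp
qed

lemma is_primitive_differentiable:
  assumes f: "is_primitive f g" and g: "continuous_on UNIV g"
  shows "(f has_real_derivative g x) (at x)"
proof -
  have "((\<lambda>y. integral {x - 1..y} g) has_real_derivative g x) (at x within {x - 1..x + 1})"
    using g by (intro integral_has_real_derivative) (auto intro: continuous_on_subset)
  then have "((\<lambda>y. f (x - 1) + integral {x - 1..y} g) has_real_derivative g x) (at x within {x - 1..x + 1})"
    by (auto intro!: derivative_eq_intros)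
  then have "(f has_real_derivative g x) (at x within {x - 1..x + 1})"
    by (rule has_field_derivative_transform_within[OF _ zero_less_one])
      (auto simp: is_primitive_on_interval[OF f])
  then show ?thesis
    by (simp add: at_within_Icc_at)
qed

lemma is_primitive_unique:
  assumes "is_primitive f g" "is_primitive f h"
  shows "AE x in lborel. g x = h x"
proof -
  have "AE x in lborel. g x - h x = 0"
    using has_integral_diff[OF is_primitive_has_integral[OF assms(1)] is_primitive_has_integral[OF assms(2)]]
      assms by (intro AE_zero_if_integrals_zero) (auto intro: locally_integrable_diff is_primitive_locally_integrable)
  then show ?thesis by simp
qed

lemma is_primitive_linear:
  assumes "is_primitive f g" "is_primitive f' g'"
  shows "is_primitive (\<lambda>x. a * f x + b * f' x) (\<lambda>x. a * g x + b * g' x)"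
  unfolding is_primitive_def
proof (intro conjI allI impI)
  show "locally_integrable (\<lambda>x. a * g x + b * g' x)"
    using assms by (intro locally_integrable_add locally_integrable_cmult is_primitive_locally_integrable)
  fix x y :: real assume "x \<le> y"
  then have "((\<lambda>x. a * g x + b * g' x) has_integral a * (f y - f x) + b * (f' y - f' x)) {x..y}"
    using assms by (intro has_integral_add has_integral_mult_right is_primitive_has_integral)
  then show "((\<lambda>x. a * g x + b * g' x) has_integral a * f y + b * f' y - (a * f x + b * f' x)) {x..y}"
    by (simp add: algebra_simps)
qed

lemma is_primitive_shift: "is_primitive f g \<Longrightarrow> is_primitive (\<lambda>x. f x + c) g"
  by (simp add: is_primitive_def)

lemma is_primitive_C1:
  assumes "\<And>x. (f has_real_derivative g x) (at x)" "continuous_on UNIV g"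
  shows "is_primitive f g"
  unfolding is_primitive_def
proof (intro conjI allI impI)
  show "locally_integrable g" using assms(2) by (rule locally_integrable_continuous)
  fix x y :: real assume "x \<le> y"
  then show "(g has_integral f y - f x) {x..y}"
    using assms(1) by (intro fundamental_theorem_of_calculus)
      (auto simp: has_real_derivative_iff_has_vector_derivative[symmetric] intro: has_field_derivative_at_within)
qed

lemma is_primitive_exists:
  assumes "locally_integrable g"
  obtains f where "is_primitive f g"
proof
  define f where "f x = (if 0 \<le> x then integral {0..x} g else - integral {x..0} g)" for x
  have int: "g integrable_on {x..y}" for x y
    using locally_integrable_has_integral[OF assms] by blast
  have "f y - f x = integral {x..y} g" if "x \<le> y" for x y
    using that Henstock_Kurzweil_Integration.integral_combine[of 0 x y g]
      Henstock_Kurzweil_Integration.integral_combine[of x 0 y g]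
      Henstock_Kurzweil_Integration.integral_combine[of x y 0 g] int
    by (auto simp: f_def)
  then show "is_primitive f g"
    using assms int by (auto simp: is_primitive_def integrable_integral)
qed

text \<open>The mean value theorem for P yields a point between f a and f b, and the intermediate
  value theorem turns this point into a value f c. No derivative of f enters, since f is only
  continuous here.\<close>

lemma chain_rule_mean_value:
  fixes f :: "real \<Rightarrow> real"
  assumes f: "continuous_on UNIV f" and "a \<le> b"
    and P: "\<And>y. y \<in> S \<Longrightarrow> (P has_real_derivative P' y) (at y)"
    and S: "is_interval S" "\<And>x. f x \<in> S"
  obtains c where "c \<in> {a..b}" "P (f b) - P (f a) = P' (f c) * (f b - f a)"
proof -
  have *: "\<exists>z. min (f a) (f b) \<le> z \<and> z \<le> max (f a) (f b) \<and> P (f b) - P (f a) = P' z * (f b - f a)"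
  proof (cases "f a" "f b" rule: linorder_cases)
    case less
    then obtain z where "f a < z" "z < f b" "P (f b) - P (f a) = (f b - f a) * P' z"
      using MVT2[of "f a" "f b" P P'] P S mem_is_interval_1_I[OF S(1)] by blast
    then show ?thesis by (intro exI[of _ z]) auto
  next
    case greater
    then obtain z where "f b < z" "z < f a" "P (f a) - P (f b) = (f a - f b) * P' z"
      using MVT2[of "f b" "f a" P P'] P S mem_is_interval_1_I[OF S(1)] by blast
    then show ?thesis by (intro exI[of _ z]) (auto simp: algebra_simps)
  qed auto
  then obtain z where z: "min (f a) (f b) \<le> z" "z \<le> max (f a) (f b)"
    "P (f b) - P (f a) = P' z * (f b - f a)" by blast
  have cont: "continuous_on {a..b} f" using f by (rule continuous_on_subset) simp
  have "connected (f ` {a..b})" by (rule connected_continuous_image[OF cont connected_Icc])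
  moreover have "f a \<in> f ` {a..b}" "f b \<in> f ` {a..b}" using \<open>a \<le> b\<close> by auto
  ultimately have "z \<in> f ` {a..b}"
    using z(1,2) connectedD_interval[of "f ` {a..b}" "f a" "f b" z]
      connectedD_interval[of "f ` {a..b}" "f b" "f a" z] by (auto simp: min_def max_def split: if_splits)
  with z(3) that show ?thesis by auto
qed

text \<open>Pointwise differentiation is bypassed. On a short interval the increment of P(f) is P'(f
  c) (f b - f a), the integral of P'(f c) g, which differs from the integral of P'(f) g by at most e
  times the integral of |g|. Bisection (\<open>Bolzano\<close>) carries this additive bound to long
  intervals, and then e tends to 0.\<close>

theorem is_primitive_compose:
  assumes f: "is_primitive f g"
    and P: "\<And>y. y \<in> S \<Longrightarrow> (P has_real_derivative P' y) (at y)" "continuous_on S P'"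
    and S: "is_interval S" "\<And>x. f x \<in> S"
  shows "is_primitive (\<lambda>x. P (f x)) (\<lambda>x. P' (f x) * g x)"
proof -
  have fc: "continuous_on UNIV f" by (rule is_primitive_continuous[OF f])
  have P'c: "continuous_on UNIV (\<lambda>x. P' (f x))"
    by (rule continuous_on_compose2[OF P(2) fc]) (use S in auto)
  have g: "locally_integrable g" by (rule is_primitive_locally_integrable[OF f])
  have Pg: "locally_integrable (\<lambda>x. P' (f x) * g x)"
    by (rule locally_integrable_mult_continuous[OF g P'c])
  have ig: "(\<lambda>x. \<bar>g x\<bar>) integrable_on {x..y}" and iP: "(\<lambda>x. P' (f x) * g x) integrable_on {x..y}" for x y
    using locally_integrable_has_integral[OF locally_integrable_abs[OF g]]
      locally_integrable_has_integral[OF Pg] by blast+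
  \<comment> \<open>The defect of the chain rule on [x, y]; it is additive in the interval, and so
    is the bound proved for it.\<close>
  define A where "A x y = P (f y) - P (f x) - integral {x..y} (\<lambda>x. P' (f x) * g x)" for x y
  have bound: "\<bar>A x y\<bar> \<le> e * integral {x..y} (\<lambda>x. \<bar>g x\<bar>)" if "x \<le> y" "e > 0" for x y e
    using \<open>x \<le> y\<close>
  proof (induction rule: Bolzano)
    case (trans a b c)
    have "integral {a..c} (\<lambda>x. P' (f x) * g x) = integral {a..b} (\<lambda>x. P' (f x) * g x) + integral {b..c} (\<lambda>x. P' (f x) * g x)"
      "integral {a..c} (\<lambda>x. \<bar>g x\<bar>) = integral {a..b} (\<lambda>x. \<bar>g x\<bar>) + integral {b..c} (\<lambda>x. \<bar>g x\<bar>)"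
      using trans ig iP by (auto intro!: Henstock_Kurzweil_Integration.integral_combine[symmetric])
    then have "A a c = A a b + A b c" and "e * integral {a..c} (\<lambda>x. \<bar>g x\<bar>) = e * integral {a..b} (\<lambda>x. \<bar>g x\<bar>) + e * integral {b..c} (\<lambda>x. \<bar>g x\<bar>)"
      by (auto simp: A_def algebra_simps)
    with trans show ?case by linarith
  next
    case (local x)
    have "isCont (\<lambda>x. P' (f x)) x" using P'c by (simp add: continuous_on_eq_continuous_at)
    then obtain d where d: "d > 0" "\<And>z. \<bar>z - x\<bar> < d \<Longrightarrow> \<bar>P' (f z) - P' (f x)\<bar> < e / 2"
      using \<open>e > 0\<close> unfolding continuous_at_eps_delta dist_real_def
      by (metis half_gt_zero)
    show ?case
    proof (intro exI[of _ d] conjI allI impI)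
      fix a b assume ab: "a \<le> x \<and> x \<le> b \<and> b - a < d"
      then have "a \<le> b" by simp
      obtain c where c: "c \<in> {a..b}" "P (f b) - P (f a) = P' (f c) * (f b - f a)"
        using chain_rule_mean_value[OF fc \<open>a \<le> b\<close> P(1) S] .
      have "((\<lambda>z. P' (f c) * g z - P' (f z) * g z) has_integral P' (f c) * (f b - f a) - integral {a..b} (\<lambda>x. P' (f x) * g x)) {a..b}"
        using \<open>a \<le> b\<close> iP by (intro has_integral_diff has_integral_mult_right is_primitive_has_integral[OF f]) (auto intro: integrable_integral)
      then have A: "((\<lambda>z. P' (f c) * g z - P' (f z) * g z) has_integral A a b) {a..b}"
        by (simp add: A_def c)
      have "norm (P' (f c) * g z - P' (f z) * g z) \<le> e * \<bar>g z\<bar>" if "z \<in> {a..b}" for z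
      proof -
        have "\<bar>P' (f z) - P' (f x)\<bar> < e / 2" "\<bar>P' (f c) - P' (f x)\<bar> < e / 2"
          using that ab c by (intro d; auto simp: abs_less_iff)+
        then have "\<bar>P' (f c) - P' (f z)\<bar> \<le> e" by linarith
        then have "\<bar>P' (f c) - P' (f z)\<bar> * \<bar>g z\<bar> \<le> e * \<bar>g z\<bar>" by (rule mult_right_mono) simp
        then show ?thesis by (simp add: abs_mult[symmetric] left_diff_distrib)
      qed
      then have "norm (integral {a..b} (\<lambda>z. P' (f c) * g z - P' (f z) * g z)) \<le> integral {a..b} (\<lambda>z. e * \<bar>g z\<bar>)"
        using A ig integrable_on_cmult_left[OF ig] by (intro integral_norm_bound_integral) auto
      with A show "\<bar>A a b\<bar> \<le> e * integral {a..b} (\<lambda>x. \<bar>g x\<bar>)"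
        by (simp add: integral_unique)
    qed (use d in simp)
  qed
  have "A x y = 0" if "x \<le> y" for x y
  proof -
    define M where "M = integral {x..y} (\<lambda>x. \<bar>g x\<bar>)"
    \<comment> \<open>The accuracy e / (M + 1), rather than e / M, covers the case M = 0.\<close>
    have "\<bar>A x y\<bar> \<le> 0 + e" if "e > 0" for e
    proof -
      have "M \<ge> 0" unfolding M_def using ig by (intro Henstock_Kurzweil_Integration.integral_nonneg) auto
      then have "\<bar>A x y\<bar> \<le> e / (M + 1) * M"
        using bound[OF \<open>x \<le> y\<close>, of "e / (M + 1)"] \<open>e > 0\<close> by (simp add: M_def)
      also have "\<dots> \<le> e" using \<open>M \<ge> 0\<close> \<open>e > 0\<close> by (simp add: field_simps)
      finally show ?thesis by simp
    qed
    then have "\<bar>A x y\<bar> \<le> 0" by (rule field_le_epsilon)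
    then show ?thesis by simp
  qed
  then show ?thesis
    using Pg iP by (auto simp: is_primitive_def A_def has_integral_iff)
qed

lemma is_primitive_power2:
  assumes "is_primitive f g"
  shows "is_primitive (\<lambda>x. (f x)\<^sup>2) (\<lambda>x. 2 * f x * g x)"
  using assms by (intro is_primitive_compose[where S = UNIV and P' = "\<lambda>x. 2 * x"])
    (auto intro!: derivative_eq_intros continuous_intros)

text \<open>The product rule follows from the chain rule by polarization.\<close>

lemma is_primitive_mult:
  assumes f: "is_primitive f g" and h: "is_primitive h k"
  shows "is_primitive (\<lambda>x. f x * h x) (\<lambda>x. f x * k x + g x * h x)"
proof -
  \<comment> \<open>2 f h = (f + h)^2 - (f^2 + h^2). The coefficients 1 and -1 give every sum the
    shape of \<open>is_primitive_linear\<close>; its last use, with weights 1/2 and 0, halves the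
    result.\<close>
  have "is_primitive (\<lambda>x. 1 * (1 * f x + 1 * h x)\<^sup>2 + (-1) * (1 * (f x)\<^sup>2 + 1 * (h x)\<^sup>2))
      (\<lambda>x. 1 * (2 * (1 * f x + 1 * h x) * (1 * g x + 1 * k x)) + (-1) * (1 * (2 * f x * g x) + 1 * (2 * h x * k x)))"
    by (intro is_primitive_linear is_primitive_power2 f h)
  from is_primitive_linear[OF this this, of "1/2" 0] show ?thesis
    by (simp add: power2_eq_square algebra_simps)
qed

section \<open>Test functions and weak derivatives\<close>

lemma test_function_support:
  assumes "test_function \<psi>"
  obtains a b where "a < b" "\<And>x. x \<notin> {a<..<b} \<Longrightarrow> \<psi> x = 0" "\<And>x. x \<notin> {a<..<b} \<Longrightarrow> deriv \<psi> x = 0"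
proof -
  have "bounded (closure {x. \<psi> x \<noteq> 0})"
    using assms by (simp add: test_function_def compact_imp_bounded)
  then have "bounded {x. \<psi> x \<noteq> 0}"
    using bounded_subset closure_subset by blast
  then obtain B where B: "B > 0" "\<And>x. \<psi> x \<noteq> 0 \<Longrightarrow> \<bar>x\<bar> \<le> B"
    by (auto simp: bounded_pos)
  then have zero: "\<psi> x = 0" if "x \<notin> {-B..B}" for x
    using that by fastforce
  have "deriv \<psi> x = 0" if "x \<notin> {-B..B}" for x
  proof (rule DERIV_imp_deriv, rule has_field_derivative_transform_within_open[of "\<lambda>x. 0" 0 x "- {-B..B}" \<psi>])
    show "open (- {-B..B})" by (simp add: open_Compl)
  qed (use that zero in auto)
  \<comment> \<open>Widening by 1 puts the end points of [-B, B], where the derivative has not been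
    shown to vanish, inside the open interval.\<close>
  with zero B(1) that[of "-B - 1" "B + 1"] show ?thesis by force
qed

lemma test_function_DERIV:
  assumes "test_function \<psi>"
  shows "(\<psi> has_real_derivative deriv \<psi> x) (at x)"
proof -
  have "\<psi> differentiable_on UNIV"
    using assms unfolding test_function_def by (metis funpow_0)
  then have "\<psi> field_differentiable (at x)"
    by (simp add: differentiable_on_def field_differentiable_def real_differentiable_def)
  then show ?thesis by (simp add: field_differentiable_derivI)
qed

lemma test_function_deriv:
  assumes "test_function \<psi>"
  shows "test_function (deriv \<psi>)"
proof -
  obtain a b where "\<And>x. x \<notin> {a<..<b} \<Longrightarrow> deriv \<psi> x = 0"
    using test_function_support[OF assms] by metis
  then have "compact (closure {x. deriv \<psi> x \<noteq> 0})"
    using compact_closure_support[of a b "deriv \<psi>"] by force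
  moreover have "(deriv ^^ j) (deriv \<psi>) differentiable_on UNIV" for j
  proof -
    have "(deriv ^^ Suc j) \<psi> differentiable_on UNIV"
      using assms unfolding test_function_def by blast
    then show ?thesis by (simp only: funpow_Suc_right comp_apply)
  qed
  ultimately show ?thesis by (simp add: test_function_def)
qed

lemma test_function_continuous: "test_function \<psi> \<Longrightarrow> continuous_on UNIV \<psi>"
  by (meson DERIV_continuous continuous_at_imp_continuous_on test_function_DERIV)

lemma test_function_is_primitive: "test_function \<psi> \<Longrightarrow> is_primitive \<psi> (deriv \<psi>)"
  by (intro is_primitive_C1 test_function_DERIV test_function_continuous test_function_deriv)

lemma integrable_mult_test_function:
  assumes "locally_integrable f" "test_function \<psi>"
  shows "integrable lborel (\<lambda>x. f x * \<psi> x)"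
proof -
  obtain a b where "\<And>x. x \<notin> {a<..<b} \<Longrightarrow> \<psi> x = 0" using test_function_support[OF assms(2)] by metis
  then have "x \<notin> {a..b} \<Longrightarrow> f x * \<psi> x = 0" for x by auto
  moreover have "locally_integrable (\<lambda>x. f x * \<psi> x)"
    using locally_integrable_mult_continuous[OF assms(1) test_function_continuous[OF assms(2)]]
    by (simp add: mult.commute)
  ultimately show ?thesis by (intro locally_integrable_compact_support)
qed

lemma higher_deriv_linear:
  assumes "\<And>j. (deriv ^^ j) f differentiable_on UNIV" "\<And>j. (deriv ^^ j) g differentiable_on UNIV"
  shows "(deriv ^^ j) (\<lambda>x. f x - c * g x) = (\<lambda>x. (deriv ^^ j) f x - c * (deriv ^^ j) g x :: real)"
proof (induction j)
  case (Suc j)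
  have "(deriv ^^ j) f field_differentiable (at x)" "(deriv ^^ j) g field_differentiable (at x)" for x
    using assms[of j] by (auto simp: differentiable_on_def field_differentiable_def real_differentiable_def)
  then show ?case
    by (auto simp: Suc fun_eq_iff intro!: DERIV_imp_deriv DERIV_diff DERIV_cmult field_differentiable_derivI)
qed simp

lemma test_function_linear:
  assumes f: "test_function f" and g: "test_function g"
  shows "test_function (\<lambda>x. f x - c * g x)"
proof -
  obtain a b where ab: "\<And>x. x \<notin> {a<..<b} \<Longrightarrow> f x = 0" using test_function_support[OF f] by metis
  obtain a' b' where ab': "\<And>x. x \<notin> {a'<..<b'} \<Longrightarrow> g x = 0" using test_function_support[OF g] by metis
  have "compact (closure {x. f x - c * g x \<noteq> 0})"
  proof (rule compact_closure_support[of "min a a'" "max b b'"])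
    fix x assume "x \<notin> {min a a'..max b b'}"
    then have "x \<notin> {a<..<b}" "x \<notin> {a'<..<b'}" by auto
    with ab ab' show "f x - c * g x = 0" by simp
  qed
  moreover have "(deriv ^^ j) (\<lambda>x. f x - c * g x) differentiable_on UNIV" for j
    using f g by (subst higher_deriv_linear)
      (auto simp: test_function_def intro!: derivative_intros)
  ultimately show ?thesis by (simp add: test_function_def)
qed

text \<open>Integration by parts: f \<psi> vanishes at both ends of an interval around the support
  of \<psi>, so its derivative f \<psi>' + g \<psi> integrates to zero.\<close>

lemma has_weak_derivative_if_is_primitive:
  assumes "is_primitive f g"
  shows "has_weak_derivative 1 f g"
  unfolding has_weak_derivative_def
proof (intro conjI allI impI)
  show f: "locally_integrable f"
    using assms by (intro locally_integrable_continuous is_primitive_continuous)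
  show g: "locally_integrable g" by (rule is_primitive_locally_integrable[OF assms])
  fix \<psi> assume \<psi>: "test_function \<psi>"
  obtain a b where ab: "a < b" "\<And>x. x \<notin> {a<..<b} \<Longrightarrow> \<psi> x = 0" "\<And>x. x \<notin> {a<..<b} \<Longrightarrow> deriv \<psi> x = 0"
    using test_function_support[OF \<psi>] by metis
  have prim: "is_primitive (\<lambda>x. f x * \<psi> x) (\<lambda>x. f x * deriv \<psi> x + g x * \<psi> x)"
    using assms \<psi> by (intro is_primitive_mult test_function_is_primitive)
  have "(LINT x|lborel. f x * deriv \<psi> x + g x * \<psi> x) = (LINT x:{a..b}|lborel. f x * deriv \<psi> x + g x * \<psi> x)"
  proof (rule locally_integrable_compact_support[OF is_primitive_locally_integrable[OF prim]])
    fix x assume "x \<notin> {a..b}"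
    then have "x \<notin> {a<..<b}" by auto
    with ab show "f x * deriv \<psi> x + g x * \<psi> x = 0" by simp
  qed
  also have "\<dots> = f b * \<psi> b - f a * \<psi> a"
    using is_primitive_has_integral[OF prim, of a b] ab(1)
      locally_integrable_has_integral[OF is_primitive_locally_integrable[OF prim], of a b]
    by (meson has_integral_unique less_imp_le)
  also have "\<dots> = 0" using ab(2)[of a] ab(2)[of b] by simp
  finally have "(LINT x|lborel. f x * deriv \<psi> x) + (LINT x|lborel. g x * \<psi> x) = 0"
    using f g \<psi> by (simp add: integrable_mult_test_function test_function_deriv)
  then show "(LINT x|lborel. f x * (deriv ^^ 1) \<psi> x) = (- 1) ^ 1 * (LINT x|lborel. g x * \<psi> x)"
    by simp
qed

lemma has_weak_derivative_unique:
  assumes "has_weak_derivative j f g" "has_weak_derivative j f h"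
  shows "AE x in lborel. g x = h x"
proof -
  have gh: "locally_integrable g" "locally_integrable h"
    using assms by (auto simp: has_weak_derivative_def)
  have "AE x in lborel. g x - h x = 0"
  proof (rule fundamental_lemma[OF locally_integrable_diff[OF gh]])
    fix \<psi> assume "test_function \<psi>"
    with gh assms show "(LINT x|lborel. (g x - h x) * \<psi> x) = 0"
      by (simp add: left_diff_distrib integrable_mult_test_function has_weak_derivative_def)
  qed
  then show ?thesis by simp
qed

text \<open>The primitive that starts at a vanishes to the left of a because \<eta> does, and to the
  right of b because the total integral of \<eta> is zero; so it has compact support.\<close>

lemma test_function_antiderivative:
  assumes \<eta>: "test_function \<eta>" and zero: "(LINT x|lborel. \<eta> x) = 0"
  obtains \<psi> where "test_function \<psi>" "deriv \<psi> = \<eta>"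
proof -
  have \<eta>c: "continuous_on UNIV \<eta>" by (rule test_function_continuous[OF \<eta>])
  obtain a b where ab: "a < b" "\<And>x. x \<notin> {a<..<b} \<Longrightarrow> \<eta> x = 0" using test_function_support[OF \<eta>] by metis
  obtain f where f: "is_primitive f \<eta>"
    using is_primitive_exists[OF locally_integrable_continuous[OF \<eta>c]] .
  define \<psi> where "\<psi> x = f x - f a" for x
  have \<psi>: "is_primitive \<psi> \<eta>" using is_primitive_shift[OF f, of "- f a"] by (simp add: \<psi>_def[abs_def])
  have D: "(\<psi> has_real_derivative \<eta> x) (at x)" for x
    by (rule is_primitive_differentiable[OF \<psi> \<eta>c])
  then have deriv: "deriv \<psi> = \<eta>" by (auto intro!: DERIV_imp_deriv)
  have same: "\<psi> x = \<psi> y" if "x \<le> y" "\<And>z. z \<in> {x..y} \<Longrightarrow> \<eta> z = 0" for x y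
  proof -
    have "(\<eta> has_integral 0) {x..y}" by (rule has_integral_is_0) (use that in auto)
    then have "\<psi> y - \<psi> x = 0"
      by (rule has_integral_unique[OF is_primitive_has_integral[OF \<psi> that(1)]])
    then show ?thesis by simp
  qed
  have "(LINT x:{a..b}|lborel. \<eta> x) = 0"
    using zero by (subst locally_integrable_compact_support(2)[OF locally_integrable_continuous[OF \<eta>c], symmetric])
      (auto intro!: ab(2))
  then have "\<psi> b - \<psi> a = 0"
    using is_primitive_has_integral[OF \<psi>, of a b] locally_integrable_has_integral[OF locally_integrable_continuous[OF \<eta>c], of a b] ab(1)
    by (metis has_integral_unique less_imp_le)
  then have "\<psi> b = 0" by (simp add: \<psi>_def)
  have "compact (closure {x. \<psi> x \<noteq> 0})"
  proof (rule compact_closure_support[of a b])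
    fix x assume "x \<notin> {a..b}"
    then consider "x < a" | "b < x" by force
    then show "\<psi> x = 0"
    proof cases
      case 1
      then show ?thesis using same[of x a] ab by (auto simp: \<psi>_def)
    next
      case 2
      then show ?thesis using same[of b x] ab \<open>\<psi> b = 0\<close> by auto
    qed
  qed
  moreover have "(deriv ^^ j) \<psi> differentiable_on UNIV" for j
  proof (cases j)
    case 0
    then show ?thesis
      using D by (auto simp: differentiable_on_def real_differentiable_def)
  next
    case (Suc i)
    then have "(deriv ^^ j) \<psi> = (deriv ^^ i) \<eta>" by (simp add: deriv funpow_swap1)
    with \<eta> show ?thesis by (simp add: test_function_def)
  qed
  ultimately have "test_function \<psi>" by (simp add: test_function_def)
  with deriv that show ?thesis by blast
qed

text \<open>
  Du Bois-Reymond: every test function is, up to a multiple of a fixed one, the derivative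
  of a test function.
\<close>

lemma weak_derivative_zero_imp_constant:
  assumes "has_weak_derivative 1 h (\<lambda>x. 0)"
  obtains c where "AE x in lborel. h x = c"
proof -
  have h: "locally_integrable h" using assms by (simp add: has_weak_derivative_def)
  define \<rho> where "\<rho> = bump 1 0 1"
  define R where "R = (LINT x|lborel. \<rho> x)"
  have \<rho>: "test_function \<rho>" by (simp add: \<rho>_def test_function_bump)
  have one: "locally_integrable (\<lambda>x. 1)" by (intro locally_integrable_continuous) auto
  have int: "integrable lborel \<eta>" if "test_function \<eta>" for \<eta>
    using integrable_mult_test_function[OF one that] by simp
  \<comment> \<open>\<open>\<rho>\<close> is positive on (0, 1), a set of positive measure.\<close>
  have "R \<noteq> 0"
  proof
    assume "R = 0"
    then have "AE x in lborel. \<rho> x = 0"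
      using integral_nonneg_eq_0_iff_AE[OF int[OF \<rho>]] bump_bounds(1) by (auto simp: R_def \<rho>_def)
    moreover have "\<not> (AE x in lborel. \<rho> x = 0)"
    proof
      assume "AE x in lborel. \<rho> x = 0"
      then have "AE x in lborel. x \<notin> {0<..<1::real}"
        by eventually_elim (use bump_pos[of 1 _ 0 1] in \<open>force simp: \<rho>_def\<close>)
      then have "{0<..<1::real} \<in> null_sets lborel" by (subst AE_iff_null_sets) auto
      then show False by (simp add: null_sets_def)
    qed
    ultimately show False by blast
  qed
  \<comment> \<open>If h is constant, testing it with \<open>\<rho>\<close> returns R times the
    constant.\<close>
  define c where "c = (LINT x|lborel. h x * \<rho> x) / R"
  have "AE x in lborel. h x - c = 0"
  proof (rule fundamental_lemma)
    show "locally_integrable (\<lambda>x. h x - c)"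
      using h by (intro locally_integrable_diff) (auto intro: locally_integrable_continuous)
    fix \<eta> assume \<eta>: "test_function \<eta>"
    \<comment> \<open>With this q the function \<eta> - q \<rho> has mean zero, so it is the
      derivative of a test function and h integrates to zero against it.\<close>
    define q where "q = (LINT x|lborel. \<eta> x) / R"
    have "(LINT x|lborel. \<eta> x - q * \<rho> x) = 0"
      using int[OF \<eta>] int[OF \<rho>] \<open>R \<noteq> 0\<close> by (simp add: q_def R_def)
    then obtain \<psi> where \<psi>: "test_function \<psi>" "deriv \<psi> = (\<lambda>x. \<eta> x - q * \<rho> x)"
      using test_function_antiderivative[OF test_function_linear[OF \<eta> \<rho>]] by metis
    have "(LINT x|lborel. h x * deriv \<psi> x) = 0"
      using assms \<psi>(1) by (simp add: has_weak_derivative_def)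
    then have "(LINT x|lborel. h x * \<eta> x - q * (h x * \<rho> x)) = 0"
      by (simp add: \<psi>(2) algebra_simps)
    then have "(LINT x|lborel. h x * \<eta> x) = q * (LINT x|lborel. h x * \<rho> x)"
      using integrable_mult_test_function[OF h \<eta>] integrable_mult_test_function[OF h \<rho>] by simp
    then show "(LINT x|lborel. (h x - c) * \<eta> x) = 0"
      using integrable_mult_test_function[OF h \<eta>] int[OF \<eta>]
      by (simp add: left_diff_distrib q_def c_def)
  qed
  with that show ?thesis by simp
qed

text \<open>Subtracting a primitive W of g leaves a function with weak derivative zero, hence a
  constant almost everywhere; W plus this constant is the continuous representative of f.\<close>

lemma has_weak_derivative_1_imp_is_primitive:
  assumes "has_weak_derivative 1 f g"
  obtains f' where "AE x in lborel. f x = f' x" "is_primitive f' g"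
proof -
  have g: "locally_integrable g" and f: "locally_integrable f" using assms by (auto simp: has_weak_derivative_def)
  obtain W where W: "is_primitive W g" using is_primitive_exists[OF g] .
  have Wl: "locally_integrable W" by (intro locally_integrable_continuous is_primitive_continuous[OF W])
  have "has_weak_derivative 1 (\<lambda>x. f x - W x) (\<lambda>x. 0)"
    unfolding has_weak_derivative_def
  proof (intro conjI allI impI)
    show "locally_integrable (\<lambda>x. f x - W x)" by (intro locally_integrable_diff f Wl)
    show "locally_integrable (\<lambda>x. 0)" by (intro locally_integrable_continuous) auto
    fix \<psi> assume \<psi>: "test_function \<psi>"
    have "(LINT x|lborel. f x * deriv \<psi> x) = (LINT x|lborel. W x * deriv \<psi> x)"
      using assms has_weak_derivative_if_is_primitive[OF W] \<psi> by (simp add: has_weak_derivative_def)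
    then show "(LINT x|lborel. (f x - W x) * (deriv ^^ 1) \<psi> x) = (- 1) ^ 1 * (LINT x|lborel. 0 * \<psi> x)"
      using integrable_mult_test_function[OF f test_function_deriv[OF \<psi>]]
        integrable_mult_test_function[OF Wl test_function_deriv[OF \<psi>]]
      by (simp add: left_diff_distrib)
  qed
  then obtain c where "AE x in lborel. f x - W x = c"
    using weak_derivative_zero_imp_constant by metis
  then have "AE x in lborel. f x = W x + c" by eventually_elim simp
  with that is_primitive_shift[OF W] show ?thesis by metis
qed

section \<open>The Sobolev space of order one on the line\<close>

lemma integrable_mult_of_squares:
  fixes f g :: "real \<Rightarrow> real"
  assumes [measurable]: "f \<in> borel_measurable borel" "g \<in> borel_measurable borel"
    and "integrable lborel (\<lambda>x. (f x)\<^sup>2)" "integrable lborel (\<lambda>x. (g x)\<^sup>2)"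
  shows "integrable lborel (\<lambda>x. f x * g x)"
proof (rule Bochner_Integration.integrable_bound)
  show "integrable lborel (\<lambda>x. (f x)\<^sup>2 + (g x)\<^sup>2)"
    using assms by (intro Bochner_Integration.integrable_add)
  have "\<bar>f x * g x\<bar> \<le> (f x)\<^sup>2 + (g x)\<^sup>2" for x
    using sum_squares_bound[of "f x" "g x"] sum_squares_bound[of "f x" "- g x"] zero_le_power2[of "f x"] zero_le_power2[of "g x"]
    by (simp add: abs_le_iff)
  then show "AE x in lborel. norm (f x * g x) \<le> norm ((f x)\<^sup>2 + (g x)\<^sup>2)"
    by simp
qed measurable

lemma integrable_square_linear:
  fixes f g :: "real \<Rightarrow> real"
  assumes "f \<in> borel_measurable borel" "g \<in> borel_measurable borel"
    and "integrable lborel (\<lambda>x. (f x)\<^sup>2)" "integrable lborel (\<lambda>x. (g x)\<^sup>2)"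
  shows "integrable lborel (\<lambda>x. (a * f x + b * g x)\<^sup>2)"
proof -
  have "integrable lborel (\<lambda>x. a\<^sup>2 * (f x)\<^sup>2 + b\<^sup>2 * (g x)\<^sup>2 + 2 * a * b * (f x * g x))"
    using integrable_mult_of_squares[OF assms] assms
    by (intro Bochner_Integration.integrable_add integrable_mult_right)
  then show ?thesis by (simp add: power2_eq_square algebra_simps)
qed

text \<open>Discriminant argument, with the minimizer r = Z / X. For X = 0 the expression is affine
  in r, and nonnegativity forces Z = 0.\<close>

lemma square_le_mult_if_quadratic_nonneg:
  fixes X Y Z :: real
  assumes "\<And>r. 0 \<le> r\<^sup>2 * X - 2 * r * Z + Y" "X \<ge> 0"
  shows "Z\<^sup>2 \<le> X * Y"
proof (cases "X = 0")
  case True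
  have "Z = 0"
  proof (rule ccontr)
    assume "Z \<noteq> 0"
    \<comment> \<open>At this r the affine expression takes the value -1.\<close>
    with assms(1)[of "(Y + 1) / (2 * Z)"] True show False by simp
  qed
  with True show ?thesis by simp
next
  case False
  then have "X > 0" using assms(2) by simp
  have "X * ((Z / X)\<^sup>2 * X - 2 * (Z / X) * Z + Y) = X * Y - Z\<^sup>2"
    using \<open>X > 0\<close> by (simp add: field_simps power2_eq_square)
  moreover have "0 \<le> X * ((Z / X)\<^sup>2 * X - 2 * (Z / X) * Z + Y)"
    using assms(1)[of "Z / X"] \<open>X > 0\<close> by simp
  ultimately show ?thesis by simp
qed

text \<open>An element of H^1 with its derivative carried along: f is the continuous representative
  and g one choice of derivative. Linear combinations then hold literally and not just almost
  everywhere, which the choice operator in \<open>weak_derivative\<close> would not give.\<close>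

definition H1_pair :: "(real \<Rightarrow> real) \<Rightarrow> (real \<Rightarrow> real) \<Rightarrow> bool" where
  "H1_pair f g \<longleftrightarrow>
     is_primitive f g \<and> integrable lborel (\<lambda>x. (f x)\<^sup>2) \<and> integrable lborel (\<lambda>x. (g x)\<^sup>2)"

definition pair_norm :: "(real \<Rightarrow> real) \<Rightarrow> (real \<Rightarrow> real) \<Rightarrow> real" where
  "pair_norm f g = sqrt ((LINT x|lborel. (f x)\<^sup>2) + (LINT x|lborel. (g x)\<^sup>2))"

lemma H1_pairD:
  assumes "H1_pair f g"
  shows "is_primitive f g" "integrable lborel (\<lambda>x. (f x)\<^sup>2)" "integrable lborel (\<lambda>x. (g x)\<^sup>2)"
    "f \<in> borel_measurable borel" "g \<in> borel_measurable borel" "continuous_on UNIV f"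
  using assms is_primitive_continuous[of f g]
  by (auto simp: H1_pair_def borel_measurable_continuous_onI
      intro: locally_integrable_measurable is_primitive_locally_integrable)

lemma H1_pair_linear:
  assumes "H1_pair f g" "H1_pair h k"
  shows "H1_pair (\<lambda>x. a * f x + b * h x) (\<lambda>x. a * g x + b * k x)"
  using H1_pairD[OF assms(1)] H1_pairD[OF assms(2)]
  by (auto simp: H1_pair_def intro!: is_primitive_linear integrable_square_linear)

lemma pair_norm_nonneg: "0 \<le> pair_norm f g"
  by (simp add: pair_norm_def)

lemma pair_norm_power2: "(pair_norm f g)\<^sup>2 = (LINT x|lborel. (f x)\<^sup>2) + (LINT x|lborel. (g x)\<^sup>2)"
  by (simp add: pair_norm_def)

lemma pair_norm_scale: "pair_norm (\<lambda>x. c * f x) (\<lambda>x. c * g x) = \<bar>c\<bar> * pair_norm f g"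
  by (simp add: pair_norm_def power_mult_distrib real_sqrt_mult flip: distrib_left)

lemma pair_norm_component_le:
  "(LINT x|lborel. (f x)\<^sup>2) \<le> (pair_norm f g)\<^sup>2" "(LINT x|lborel. (g x)\<^sup>2) \<le> (pair_norm f g)\<^sup>2"
  by (simp_all add: pair_norm_power2)

lemma pair_norm_add_power2:
  assumes "H1_pair f g" "H1_pair h k"
  shows "(pair_norm (\<lambda>x. a * f x + b * h x) (\<lambda>x. a * g x + b * k x))\<^sup>2 =
    a\<^sup>2 * (pair_norm f g)\<^sup>2 + 2 * a * b * ((LINT x|lborel. f x * h x) + (LINT x|lborel. g x * k x))
      + b\<^sup>2 * (pair_norm h k)\<^sup>2"
proof -
  note D = H1_pairD[OF assms(1)] H1_pairD[OF assms(2)]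
  have *: "(LINT x|lborel. (a * u x + b * v x)\<^sup>2) =
      a\<^sup>2 * (LINT x|lborel. (u x)\<^sup>2) + 2 * a * b * (LINT x|lborel. u x * v x) + b\<^sup>2 * (LINT x|lborel. (v x)\<^sup>2)"
    if "u \<in> borel_measurable borel" "v \<in> borel_measurable borel"
      "integrable lborel (\<lambda>x. (u x)\<^sup>2)" "integrable lborel (\<lambda>x. (v x)\<^sup>2)" for u v :: "real \<Rightarrow> real"
  proof -
    have "(LINT x|lborel. (a * u x + b * v x)\<^sup>2) =
      (LINT x|lborel. a\<^sup>2 * (u x)\<^sup>2 + 2 * a * b * (u x * v x) + b\<^sup>2 * (v x)\<^sup>2)"
      by (simp add: power2_eq_square algebra_simps)
    then show ?thesis
      using that integrable_mult_of_squares[OF that] by simp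
  qed
  show ?thesis
    unfolding pair_norm_power2 using D by (simp add: * algebra_simps)
qed

lemma pair_Cauchy_Schwarz:
  assumes "H1_pair f g" "H1_pair h k"
  shows "\<bar>(LINT x|lborel. f x * h x) + (LINT x|lborel. g x * k x)\<bar> \<le> pair_norm f g * pair_norm h k"
proof -
  let ?Z = "(LINT x|lborel. f x * h x) + (LINT x|lborel. g x * k x)"
  have "?Z\<^sup>2 \<le> (pair_norm f g)\<^sup>2 * (pair_norm h k)\<^sup>2"
  proof (rule square_le_mult_if_quadratic_nonneg)
    fix r
    have "(pair_norm (\<lambda>x. r * f x + (-1) * h x) (\<lambda>x. r * g x + (-1) * k x))\<^sup>2 =
        r\<^sup>2 * (pair_norm f g)\<^sup>2 - 2 * r * ?Z + (pair_norm h k)\<^sup>2"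
      using pair_norm_add_power2[OF assms, of r "-1"] by simp
    then show "0 \<le> r\<^sup>2 * (pair_norm f g)\<^sup>2 - 2 * r * ?Z + (pair_norm h k)\<^sup>2"
      by (metis zero_le_power2)
  qed simp
  then have "?Z\<^sup>2 \<le> (pair_norm f g * pair_norm h k)\<^sup>2" by (simp add: power_mult_distrib)
  then show ?thesis
    using abs_le_square_iff[of ?Z "pair_norm f g * pair_norm h k"]
    by (simp add: pair_norm_nonneg abs_mult)
qed

lemma pair_norm_triangle:
  assumes "H1_pair f g" "H1_pair h k"
  shows "pair_norm (\<lambda>x. f x + h x) (\<lambda>x. g x + k x) \<le> pair_norm f g + pair_norm h k"
proof (rule power2_le_imp_le)
  show "(pair_norm (\<lambda>x. f x + h x) (\<lambda>x. g x + k x))\<^sup>2 \<le> (pair_norm f g + pair_norm h k)\<^sup>2"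
    using pair_norm_add_power2[OF assms, of 1 1] pair_Cauchy_Schwarz[OF assms]
    by (simp add: power2_sum)
qed (simp add: pair_norm_nonneg)

text \<open>The discriminant argument applied to |f| and |g|, since the energy estimates need the
  absolute values under the integral.\<close>

lemma integral_mult_le_norms:
  fixes f g :: "real \<Rightarrow> real"
  assumes [measurable]: "f \<in> borel_measurable borel" "g \<in> borel_measurable borel"
    and "integrable lborel (\<lambda>x. (f x)\<^sup>2)" "integrable lborel (\<lambda>x. (g x)\<^sup>2)"
  shows "(LINT x|lborel. \<bar>f x\<bar> * \<bar>g x\<bar>) \<le> sqrt (LINT x|lborel. (f x)\<^sup>2) * sqrt (LINT x|lborel. (g x)\<^sup>2)"
proof -
  let ?Z = "LINT x|lborel. \<bar>f x\<bar> * \<bar>g x\<bar>"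
  have fg: "integrable lborel (\<lambda>x. \<bar>f x\<bar> * \<bar>g x\<bar>)"
    using integrable_mult_of_squares[OF assms] by (simp add: abs_mult[symmetric])
  have "?Z\<^sup>2 \<le> (LINT x|lborel. (f x)\<^sup>2) * (LINT x|lborel. (g x)\<^sup>2)"
  proof (rule square_le_mult_if_quadratic_nonneg)
    fix r
    have "0 \<le> (LINT x|lborel. (r * \<bar>f x\<bar> - \<bar>g x\<bar>)\<^sup>2)" by simp
    also have "\<dots> = (LINT x|lborel. r\<^sup>2 * (f x)\<^sup>2 - 2 * r * (\<bar>f x\<bar> * \<bar>g x\<bar>) + (g x)\<^sup>2)"
      by (intro Bochner_Integration.integral_cong) (auto simp: power2_diff power_mult_distrib)
    also have "\<dots> = r\<^sup>2 * (LINT x|lborel. (f x)\<^sup>2) - 2 * r * ?Z + (LINT x|lborel. (g x)\<^sup>2)"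
      using fg assms by simp
    finally show "0 \<le> r\<^sup>2 * (LINT x|lborel. (f x)\<^sup>2) - 2 * r * ?Z + (LINT x|lborel. (g x)\<^sup>2)" .
  qed simp
  then show ?thesis
    by (simp add: real_le_rsqrt flip: real_sqrt_mult)
qed

text \<open>f(x)^2 - f(y)^2 is minus the integral of 2 f g over [x, y], at most the integral M of
  f^2 + g^2 over the unit window. Averaging over y bounds the remaining f(y)^2 by M as well, whence
  the factor 2. Only one window enters, so the estimate yields both the sup bound and the decay at
  infinity.\<close>

lemma H1_pair_square_le_local:
  assumes "H1_pair f g"
  shows "(f x)\<^sup>2 \<le> 2 * (LINT y:{x..x + 1}|lborel. (f y)\<^sup>2 + (g y)\<^sup>2)"
proof -
  note D = H1_pairD[OF assms]
  define q where "q y = (f y)\<^sup>2 + (g y)\<^sup>2" for y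
  define M where "M = (LINT y:{x..x + 1}|lborel. q y)"
  have qint: "integrable lborel q" unfolding q_def[abs_def] using D by simp
  have "locally_integrable q"
    unfolding locally_integrable_def set_integrable_def
    by (auto intro!: integrable_mult_indicator[where f = q and A = "{_.._}", simplified] qint)
  then have q: "(q has_integral M) {x..x + 1}" unfolding M_def
    by (rule locally_integrable_has_integral)
  have le: "(f x)\<^sup>2 \<le> q y + M" if y: "y \<in> {x..x + 1}" for y
  proof -
    have "((\<lambda>z. 2 * f z * g z) has_integral (f y)\<^sup>2 - (f x)\<^sup>2) {x..y}"
      using is_primitive_has_integral[OF is_primitive_power2[OF D(1)], of x y] y by simp
    then have "((\<lambda>z. - (2 * f z * g z)) has_integral - ((f y)\<^sup>2 - (f x)\<^sup>2)) {x..y}"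
      by (rule has_integral_neg)
    moreover have qy: "q integrable_on {x..y}"
      using q y by (auto intro: integrable_on_subinterval)
    moreover have "- (2 * f z * g z) \<le> q z" for z
      using zero_le_power2[of "f z + g z"] unfolding q_def power2_sum by linarith
    ultimately have "- ((f y)\<^sup>2 - (f x)\<^sup>2) \<le> integral {x..y} q"
      by (intro has_integral_le[OF _ integrable_integral]) auto
    also have "\<dots> \<le> integral {x..x + 1} q"
      using q qy y by (intro integral_subset_le) (auto simp: q_def)
    also have "\<dots> = M" using q by (rule integral_unique)
    finally have "(f x)\<^sup>2 \<le> (f y)\<^sup>2 + M" by simp
    then show ?thesis using zero_le_power2[of "g y"] unfolding q_def by linarith
  qed
  have "((\<lambda>y. (f x)\<^sup>2) has_integral (f x)\<^sup>2) {x..x + 1}"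
    using has_integral_const_real[of "(f x)\<^sup>2" x "x + 1"] by simp
  moreover have "((\<lambda>y. q y + M) has_integral (M + M)) {x..x + 1}"
    using has_integral_add[OF q has_integral_const_real[of M x "x + 1"]] by simp
  ultimately have "(f x)\<^sup>2 \<le> M + M" using le by (rule has_integral_le)
  then show ?thesis by (simp add: M_def q_def)
qed

text \<open>The constant is sqrt 2 rounded up. It fixes the threshold for \<epsilon>: a norm below
  1/4 keeps |f| below 1/2.\<close>

lemma H1_pair_sup_bound:
  assumes "H1_pair f g"
  shows "\<bar>f x\<bar> \<le> 2 * pair_norm f g"
proof -
  note D = H1_pairD[OF assms]
  have "(LINT y:{x..x + 1}|lborel. (f y)\<^sup>2 + (g y)\<^sup>2) \<le> (LINT y|lborel. (f y)\<^sup>2 + (g y)\<^sup>2)"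
    unfolding set_lebesgue_integral_def using D
    by (intro integral_mono integrable_mult_indicator[where 'b = real]) (auto simp: indicator_def)
  also have "\<dots> = (pair_norm f g)\<^sup>2" using D by (simp add: pair_norm_power2)
  finally have "(f x)\<^sup>2 \<le> 2 * (pair_norm f g)\<^sup>2" using H1_pair_square_le_local[OF assms, of x] by simp
  also have "\<dots> \<le> (2 * pair_norm f g)\<^sup>2" by (simp add: power_mult_distrib)
  finally show ?thesis using abs_le_square_iff[of "f x" "2 * pair_norm f g"] by (simp add: pair_norm_nonneg)
qed

text \<open>The integral of f^2 + g^2 over a unit window moving off to infinity tends to zero by
  dominated convergence, and twice this integral bounds f^2 at the left end of the window.\<close>

lemma H1_pair_decay:
  assumes "H1_pair f g"
  shows "(\<lambda>i. f (real i)) \<longlonglongrightarrow> 0" "(\<lambda>i. f (- real i)) \<longlonglongrightarrow> 0"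
proof -
  note D = H1_pairD[OF assms]
  have *: "(\<lambda>i. f (X i)) \<longlonglongrightarrow> 0" if X: "\<And>y. \<forall>\<^sub>F i in sequentially. y \<notin> {X i..X i + 1}" for X :: "nat \<Rightarrow> real"
  proof -
    have [measurable]: "f \<in> borel_measurable borel" "g \<in> borel_measurable borel" using D by auto
    have "(\<lambda>i. LINT y:{X i..X i + 1}|lborel. (f y)\<^sup>2 + (g y)\<^sup>2) \<longlonglongrightarrow> (LINT y::real|lborel. (0::real))"
      unfolding set_lebesgue_integral_def
    proof (rule integral_dominated_convergence)
      show "integrable lborel (\<lambda>y. (f y)\<^sup>2 + (g y)\<^sup>2)" using D by simp
      show "AE y in lborel. (\<lambda>i. indicator {X i..X i + 1} y *\<^sub>R ((f y)\<^sup>2 + (g y)\<^sup>2)) \<longlonglongrightarrow> 0"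
      proof (intro AE_I2 tendsto_eventually)
        fix y show "\<forall>\<^sub>F i in sequentially. indicator {X i..X i + 1} y *\<^sub>R ((f y)\<^sup>2 + (g y)\<^sup>2) = 0"
          using X[of y] by eventually_elim simp
      qed
      show "AE y in lborel. norm (indicator {X i..X i + 1} y *\<^sub>R ((f y)\<^sup>2 + (g y)\<^sup>2)) \<le> (f y)\<^sup>2 + (g y)\<^sup>2" for i
        by (auto simp: indicator_def)
    qed measurable
    then have "(\<lambda>i. 2 * (LINT y:{X i..X i + 1}|lborel. (f y)\<^sup>2 + (g y)\<^sup>2)) \<longlonglongrightarrow> 0"
      using tendsto_mult_right_zero by fastforce
    then have "(\<lambda>i. (f (X i))\<^sup>2) \<longlonglongrightarrow> 0"
      by (rule Lim_null_comparison[rotated])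
        (intro always_eventually allI, use H1_pair_square_le_local[OF assms] in simp)
    then show ?thesis by simp
  qed
  show "(\<lambda>i. f (real i)) \<longlonglongrightarrow> 0"
  proof (rule *)
    fix y :: real
    obtain k :: nat where "y < real k" using reals_Archimedean2 by blast
    then show "\<forall>\<^sub>F i in sequentially. y \<notin> {real i..real i + 1}"
      by (intro eventually_sequentiallyI[of k]) auto
  qed
  show "(\<lambda>i. f (- real i)) \<longlonglongrightarrow> 0"
  proof (rule *)
    fix y :: real
    \<comment> \<open>The window reaches to -i + 1, so i has to exceed 1 - y.\<close>
    obtain k :: nat where "- y + 1 < real k" using reals_Archimedean2 by blast
    then show "\<forall>\<^sub>F i in sequentially. y \<notin> {- real i..- real i + 1}"
      by (intro eventually_sequentiallyI[of k]) auto
  qed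
qed

text \<open>The integral over [-i, i] is an increment of K, and the two ends have the same
  limit.\<close>

lemma integral_derivative_eq_0:
  assumes K: "is_primitive K k" "integrable lborel k"
    and lim: "(\<lambda>i. K (real i)) \<longlonglongrightarrow> c" "(\<lambda>i. K (- real i)) \<longlonglongrightarrow> c"
  shows "(LINT x|lborel. k x) = 0"
proof -
  have [measurable]: "k \<in> borel_measurable borel" using K(2) borel_measurable_integrable by fastforce
  have "(\<lambda>i. LINT x:{- real i..real i}|lborel. k x) \<longlonglongrightarrow> (LINT x|lborel. k x)"
    unfolding set_lebesgue_integral_def
  proof (rule integral_dominated_convergence)
    show "integrable lborel (\<lambda>x. \<bar>k x\<bar>)" using K(2) by simp
    show "AE x in lborel. (\<lambda>i. indicator {- real i..real i} x *\<^sub>R k x) \<longlonglongrightarrow> k x"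
    proof (intro AE_I2 tendsto_eventually)
      fix x :: real
      obtain j :: nat where "\<bar>x\<bar> < real j" using reals_Archimedean2 by blast
      then show "\<forall>\<^sub>F i in sequentially. indicator {- real i..real i} x *\<^sub>R k x = k x"
        by (intro eventually_sequentiallyI[of j]) (auto simp: indicator_def)
    qed
    show "AE x in lborel. norm (indicator {- real i..real i} x *\<^sub>R k x) \<le> \<bar>k x\<bar>" for i
      by (auto simp: indicator_def)
  qed measurable
  moreover have "(LINT x:{- real i..real i}|lborel. k x) = K (real i) - K (- real i)" for i
    using has_integral_unique[OF locally_integrable_has_integral[OF is_primitive_locally_integrable[OF K(1)]]
        is_primitive_has_integral[OF K(1), of "- real i" "real i"]] by simp
  ultimately have "(\<lambda>i. K (real i) - K (- real i)) \<longlonglongrightarrow> (LINT x|lborel. k x)" by simp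
  moreover have "(\<lambda>i. K (real i) - K (- real i)) \<longlonglongrightarrow> c - c" using lim by (intro tendsto_diff)
  ultimately show ?thesis using LIMSEQ_unique by fastforce
qed

section \<open>Independence of the representative; Sobolev norms through pairs\<close>

lemma locally_integrable_cong_AE:
  assumes "locally_integrable f" "AE x in lborel. h x = f x" "h \<in> borel_measurable borel"
  shows "locally_integrable h"
  unfolding locally_integrable_def
proof (intro allI)
  fix a b :: real
  have [measurable]: "f \<in> borel_measurable borel" "h \<in> borel_measurable borel"
    using assms locally_integrable_measurable by auto
  have "set_integrable lborel {a..b} h = set_integrable lborel {a..b} f"
    using assms(2) by (intro set_integrable_cong_AE) auto
  then show "set_integrable lborel {a..b} h" using locally_integrable_set[OF assms(1)] by simp
qed

lemma has_weak_derivative_cong_AE: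
  assumes wd: "has_weak_derivative j f g" and h: "AE x in lborel. h x = f x" "h \<in> borel_measurable borel"
  shows "has_weak_derivative j h g"
proof -
  have f: "locally_integrable f" using wd by (simp add: has_weak_derivative_def)
  have [measurable]: "f \<in> borel_measurable borel" "h \<in> borel_measurable borel"
    using h f locally_integrable_measurable by auto
  have "(LINT x|lborel. h x * (deriv ^^ j) \<psi> x) = (LINT x|lborel. f x * (deriv ^^ j) \<psi> x)"
    if "test_function \<psi>" for \<psi>
  proof (rule integral_cong_AE)
    have "continuous_on UNIV ((deriv ^^ j) \<psi>)"
      using that by (simp add: test_function_def differentiable_imp_continuous_on)
    then have [measurable]: "(deriv ^^ j) \<psi> \<in> borel_measurable borel"
      by (rule borel_measurable_continuous_onI)
    show "(\<lambda>x. h x * (deriv ^^ j) \<psi> x) \<in> borel_measurable lborel"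
      "(\<lambda>x. f x * (deriv ^^ j) \<psi> x) \<in> borel_measurable lborel" by measurable
    show "AE x in lborel. h x * (deriv ^^ j) \<psi> x = f x * (deriv ^^ j) \<psi> x"
      using h(1) by eventually_elim simp
  qed
  with wd locally_integrable_cong_AE[OF f h] show ?thesis
    by (simp add: has_weak_derivative_def)
qed

lemma has_weak_derivative_0: "locally_integrable f \<Longrightarrow> has_weak_derivative 0 f f"
  by (simp add: has_weak_derivative_def)

lemma weak_derivative_AE:
  assumes "has_weak_derivative j f g"
  shows "has_weak_derivative j f (weak_derivative j f)" "AE x in lborel. weak_derivative j f x = g x"
proof -
  show *: "has_weak_derivative j f (weak_derivative j f)"
    unfolding weak_derivative_def using assms by (rule someI[where P = "has_weak_derivative j f"])
  show "AE x in lborel. weak_derivative j f x = g x"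
    by (rule has_weak_derivative_unique[OF * assms])
qed

lemma has_weak_derivative_measurable:
  "has_weak_derivative j f g \<Longrightarrow> g \<in> borel_measurable borel"
  by (simp add: has_weak_derivative_def locally_integrable_measurable)

lemma integral_square_cong_AE:
  fixes f g :: "real \<Rightarrow> real"
  assumes "AE x in lborel. f x = g x" and [measurable]: "f \<in> borel_measurable borel" "g \<in> borel_measurable borel"
  shows "(LINT x|lborel. (f x)\<^sup>2) = (LINT x|lborel. (g x)\<^sup>2)"
    "integrable lborel (\<lambda>x. (f x)\<^sup>2) \<longleftrightarrow> integrable lborel (\<lambda>x. (g x)\<^sup>2)"
proof -
  have "AE x in lborel. (f x)\<^sup>2 = (g x)\<^sup>2" using assms(1) by eventually_elim simp
  then show "(LINT x|lborel. (f x)\<^sup>2) = (LINT x|lborel. (g x)\<^sup>2)"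
    "integrable lborel (\<lambda>x. (f x)\<^sup>2) \<longleftrightarrow> integrable lborel (\<lambda>x. (g x)\<^sup>2)"
    by (intro integral_cong_AE integrable_cong_AE; measurable)+
qed

text \<open>Passage from the norm built on a choice of derivative to \<open>pair_norm\<close>. That
  h agrees with f only almost everywhere matters for the time derivative in the C^1 condition, which
  is not given by its continuous representative.\<close>

lemma sobolev_1_if_H1_pair:
  assumes "H1_pair f g" "AE x in lborel. h x = f x" "h \<in> borel_measurable borel"
  shows "h \<in> sobolev 1" "sobolev_norm 1 h = pair_norm f g" "AE x in lborel. weak_derivative 1 h x = g x"
proof -
  note D = H1_pairD[OF assms(1)]
  have wd1: "has_weak_derivative 1 h g"
    using has_weak_derivative_cong_AE[OF has_weak_derivative_if_is_primitive[OF D(1)] assms(2,3)] .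
  have "locally_integrable h"
    using locally_integrable_cong_AE[OF locally_integrable_continuous[OF D(6)] assms(2,3)] .
  then have wd0: "has_weak_derivative 0 h h" by (rule has_weak_derivative_0)
  have sq: "square_integrable h" "square_integrable g"
    using integral_square_cong_AE(2)[OF assms(2,3) D(4)] D assms(3) by (auto simp: square_integrable_def)
  then show "h \<in> sobolev 1"
    using wd0 wd1 by (auto simp: sobolev_def le_Suc_eq)
  show "AE x in lborel. weak_derivative 1 h x = g x" by (rule weak_derivative_AE(2)[OF wd1])
  have "(LINT x|lborel. (weak_derivative 1 h x)\<^sup>2) = (LINT x|lborel. (g x)\<^sup>2)"
    using weak_derivative_AE[OF wd1] D by (intro integral_square_cong_AE(1)) (auto intro: has_weak_derivative_measurable)
  moreover have "(LINT x|lborel. (weak_derivative 0 h x)\<^sup>2) = (LINT x|lborel. (h x)\<^sup>2)"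
    using weak_derivative_AE[OF wd0] assms(3) by (intro integral_square_cong_AE(1)) (auto intro: has_weak_derivative_measurable)
  moreover have "(LINT x|lborel. (h x)\<^sup>2) = (LINT x|lborel. (f x)\<^sup>2)"
    by (rule integral_square_cong_AE(1)[OF assms(2,3) D(4)])
  ultimately show "sobolev_norm 1 h = pair_norm f g"
    by (simp add: sobolev_norm_def pair_norm_def)
qed

lemma sobolev_1_imp_H1_pair:
  assumes "h \<in> sobolev 1"
  obtains f where "AE x in lborel. h x = f x" "H1_pair f (weak_derivative 1 h)"
proof -
  obtain g where g: "square_integrable g" "has_weak_derivative 1 h g" and h: "square_integrable h"
    using assms by (auto simp: sobolev_def)
  note wd = weak_derivative_AE[OF g(2)]
  obtain f where f: "AE x in lborel. h x = f x" "is_primitive f (weak_derivative 1 h)"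
    using has_weak_derivative_1_imp_is_primitive[OF wd(1)] .
  have "f \<in> borel_measurable borel" 
    using f(2) by (intro borel_measurable_continuous_onI is_primitive_continuous)
  then have "integrable lborel (\<lambda>x. (f x)\<^sup>2)"
    using integral_square_cong_AE(2)[OF f(1)] h by (simp add: square_integrable_def)
  moreover have "integrable lborel (\<lambda>x. (weak_derivative 1 h x)\<^sup>2)"
    using integral_square_cong_AE(2)[OF wd(2) has_weak_derivative_measurable[OF wd(1)]] g
    by (simp add: square_integrable_def)
  ultimately show ?thesis using that f by (simp add: H1_pair_def)
qed

text \<open>The set of disagreement is open, and a nonempty open set is not negligible.\<close>

lemma continuous_AE_eq:
  fixes f g :: "real \<Rightarrow> real"
  assumes "continuous_on UNIV f" "continuous_on UNIV g" "AE x in lborel. f x = g x"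
  shows "f = g"
proof -
  have "open {x. f x \<noteq> g x}" using assms by (intro open_Collect_neq)
  moreover have "negligible {x. f x \<noteq> g x}"
  proof -
    have "{x. f x \<noteq> g x} \<in> null_sets lborel"
      using assms(3) \<open>open {x. f x \<noteq> g x}\<close> by (subst AE_iff_null_sets) auto
    then show ?thesis by (simp add: negligible_iff_null_sets null_sets_completionI)
  qed
  ultimately have "{x. f x \<noteq> g x} = {}" using open_not_negligible by blast
  then show ?thesis by auto
qed

text \<open>A continuous function is itself the continuous representative of its class, so \<phi> -
  1 and u can be used without modification on null sets.\<close>

lemma sobolev_1_continuous_imp_H1_pair:
  assumes "h \<in> sobolev 1" "continuous_on UNIV h"
  shows "H1_pair h (weak_derivative 1 h)"
proof -
  obtain f where f: "AE x in lborel. h x = f x" "H1_pair f (weak_derivative 1 h)"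
    using sobolev_1_imp_H1_pair[OF assms(1)] .
  with continuous_AE_eq[OF assms(2) H1_pairD(6)[OF f(2)]] show ?thesis by simp
qed

lemma sobolev_mono: "1 \<le> k \<Longrightarrow> sobolev k \<subseteq> sobolev 1"
  by (force simp: sobolev_def)

lemma sobolev_norm_mono: "1 \<le> k \<Longrightarrow> sobolev_norm 1 f \<le> sobolev_norm k f"
  unfolding sobolev_norm_def by (intro real_sqrt_le_mono sum_mono2) auto

section \<open>Differentiability and coercivity of the energy\<close>

lemma Taylor_2:
  fixes f :: "real \<Rightarrow> real"
  assumes "\<And>z. z \<in> {a..b} \<Longrightarrow> (f has_real_derivative f' z) (at z)"
    and "\<And>z. z \<in> {a..b} \<Longrightarrow> (f' has_real_derivative f'' z) (at z)"
    and xy: "x \<in> {a..b}" "y \<in> {a..b}"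
  obtains z where "z \<in> {a..b}" "f y = f x + f' x * (y - x) + f'' z / 2 * (y - x)\<^sup>2"
proof (cases "x = y")
  case True
  with that[of x] xy show ?thesis by simp
next
  case False
  define diff where "diff i = (if i = 0 then f else if i = 1 then f' else f'')" for i :: nat
  have "\<forall>i t. i < 2 \<and> a \<le> t \<and> t \<le> b \<longrightarrow> (diff i has_real_derivative diff (Suc i) t) (at t)"
    using assms(1,2) by (auto simp: diff_def less_2_cases_iff)
  then obtain z where z: "if y < x then y < z \<and> z < x else x < z \<and> z < y"
    "f y = (\<Sum>i<2. diff i x / fact i * (y - x) ^ i) + diff 2 z / fact 2 * (y - x) ^ 2"
    using Taylor[of 2 diff f a b x y] xy False by (auto simp: diff_def)
  have "z \<in> {a..b}" using z(1) xy by (auto split: if_splits)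
  moreover have "f y = f x + f' x * (y - x) + f'' z / 2 * (y - x)\<^sup>2"
    using z(2) by (simp add: diff_def numeral_2_eq_2)
  ultimately show ?thesis using that by blast
qed

lemma integrable_mult_bounded:
  fixes q w :: "real \<Rightarrow> real"
  assumes w: "integrable lborel w" and [measurable]: "q \<in> borel_measurable borel" and q: "\<And>x. \<bar>q x\<bar> \<le> C"
  shows "integrable lborel (\<lambda>x. q x * w x)"
proof (rule Bochner_Integration.integrable_bound)
  have [measurable]: "w \<in> borel_measurable borel" using w borel_measurable_integrable by fastforce
  show "integrable lborel (\<lambda>x. C * w x)" using w by simp
  show "(\<lambda>x. q x * w x) \<in> borel_measurable lborel" by measurable
  have "\<bar>q x\<bar> * \<bar>w x\<bar> \<le> \<bar>C\<bar> * \<bar>w x\<bar>" for x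
    using q[of x] by (intro mult_right_mono) auto
  then show "AE x in lborel. norm (q x * w x) \<le> norm (C * w x)"
    by (simp add: abs_mult)
qed

text \<open>The density p(\<phi>) \<phi>_z^2 + F(\<phi>) near the equilibrium 1, on a compact
  interval away from the singularity of powers at 0. The lower bound 2 c for F'' compensates the 1/2
  in Taylor's formula, so that gradient and potential part are coercive with the same c; one C
  serves for all upper bounds.\<close>

locale energy_density =
  fixes p p' p'' F F' F'' :: "real \<Rightarrow> real" and c C :: real
  assumes p: "\<And>z. z \<in> {1/2..3/2} \<Longrightarrow> (p has_real_derivative p' z) (at z)"
    and p': "\<And>z. z \<in> {1/2..3/2} \<Longrightarrow> (p' has_real_derivative p'' z) (at z)"
    and F: "\<And>z. z \<in> {1/2..3/2} \<Longrightarrow> (F has_real_derivative F' z) (at z)"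
    and F': "\<And>z. z \<in> {1/2..3/2} \<Longrightarrow> (F' has_real_derivative F'' z) (at z)"
    and F_1: "F 1 = 0" and F'_1: "F' 1 = 0"
    and c_pos: "0 < c"
    and p_bounds: "\<And>z. z \<in> {1/2..3/2} \<Longrightarrow> c \<le> p z \<and> p z \<le> C"
    and F''_bounds: "\<And>z. z \<in> {1/2..3/2} \<Longrightarrow> 2 * c \<le> F'' z \<and> F'' z \<le> C"
    and p'_bound: "\<And>z. z \<in> {1/2..3/2} \<Longrightarrow> \<bar>p' z\<bar> \<le> C"
    and p''_bound: "\<And>z. z \<in> {1/2..3/2} \<Longrightarrow> \<bar>p'' z\<bar> \<le> C"
begin

definition energy :: "(real \<Rightarrow> real) \<Rightarrow> (real \<Rightarrow> real) \<Rightarrow> real" where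
  "energy f g = (LINT x|lborel. p (1 + f x) * (g x)\<^sup>2 + F (1 + f x))"

text \<open>The directional derivative of the energy at (f, g) along (h, k), where k stands for the
  derivative of h.\<close>

definition energy_deriv ::
    "(real \<Rightarrow> real) \<Rightarrow> (real \<Rightarrow> real) \<Rightarrow> (real \<Rightarrow> real) \<Rightarrow> (real \<Rightarrow> real) \<Rightarrow> real" where
  "energy_deriv f g h k =
     (LINT x|lborel. p' (1 + f x) * (g x)\<^sup>2 * h x + 2 * p (1 + f x) * g x * k x + F' (1 + f x) * h x)"

lemma C_pos: "0 < C"
  using p_bounds[of 1] c_pos by simp

lemma in_range: "\<bar>y :: real\<bar> \<le> 1/2 \<Longrightarrow> 1 + y \<in> {1/2..3/2}"
  unfolding atLeastAtMost_iff by linarith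

text \<open>Taylor's formula at 1, where F and F' vanish.\<close>

lemma F_bounds:
  assumes "\<bar>y\<bar> \<le> 1/2"
  shows "c * y\<^sup>2 \<le> F (1 + y)" "F (1 + y) \<le> C * y\<^sup>2"
proof -
  obtain z where "z \<in> {1/2..3/2}" and z: "F (1 + y) = F'' z / 2 * y\<^sup>2"
    using Taylor_2[OF F F' in_range[of 0] in_range[OF assms]] F_1 F'_1 by auto
  then have *: "c \<le> F'' z / 2" "F'' z / 2 \<le> C" using F''_bounds[of z] c_pos by auto
  then show "c * y\<^sup>2 \<le> F (1 + y)" "F (1 + y) \<le> C * y\<^sup>2"
    unfolding z by (intro mult_right_mono * zero_le_power2)+
qed

lemma lipschitz_bound:
  fixes f :: "real \<Rightarrow> real"
  assumes "\<And>z. z \<in> {1/2..3/2} \<Longrightarrow> (f has_real_derivative f' z) (at z)"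
    and "\<And>z. z \<in> {1/2..3/2} \<Longrightarrow> \<bar>f' z\<bar> \<le> C" and "x \<in> {1/2..3/2}" "y \<in> {1/2..3/2}"
  shows "\<bar>f y - f x\<bar> \<le> C * \<bar>y - x\<bar>"
  using field_differentiable_bound[of "{1/2..3/2}" f f' C y x] assms
  by (auto intro: has_field_derivative_at_within)

lemma F'_bound:
  assumes "\<bar>y\<bar> \<le> 1/2"
  shows "\<bar>F' (1 + y)\<bar> \<le> C * \<bar>y\<bar>"
proof -
  have "\<bar>F'' z\<bar> \<le> C" if "z \<in> {1/2..3/2}" for z
    using F''_bounds[OF that] c_pos by simp
  from lipschitz_bound[OF F' this in_range[of 0] in_range[OF assms]] F'_1 show ?thesis
    by simp
qed

lemma borel_measurable_coefficients:
  assumes f: "continuous_on UNIV f" "\<And>x. \<bar>f x :: real\<bar> \<le> 1/2"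
  shows "(\<lambda>x. p (1 + f x)) \<in> borel_measurable borel" "(\<lambda>x. p' (1 + f x)) \<in> borel_measurable borel"
    "(\<lambda>x. F (1 + f x)) \<in> borel_measurable borel" "(\<lambda>x. F' (1 + f x)) \<in> borel_measurable borel"
proof -
  have *: "(\<lambda>x. q (1 + f x)) \<in> borel_measurable borel"
    if q: "\<And>z. z \<in> {1/2..3/2} \<Longrightarrow> (q has_real_derivative q' z) (at z)" for q q' :: "real \<Rightarrow> real"
  proof (rule borel_measurable_continuous_onI, rule continuous_on_compose2[of "{1/2..3/2}" q])
    show "continuous_on {1/2..3/2} q"
      using q by (meson DERIV_isCont continuous_at_imp_continuous_on)
    show "continuous_on UNIV (\<lambda>x. 1 + f x)" using f by (intro continuous_intros)
    show "(\<lambda>x. 1 + f x) ` UNIV \<subseteq> {1/2..3/2}" using in_range[OF f(2)] by blast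
  qed
  show "(\<lambda>x. p (1 + f x)) \<in> borel_measurable borel" "(\<lambda>x. p' (1 + f x)) \<in> borel_measurable borel"
    "(\<lambda>x. F (1 + f x)) \<in> borel_measurable borel" "(\<lambda>x. F' (1 + f x)) \<in> borel_measurable borel"
    using *[OF p] *[OF p'] *[OF F] *[OF F'] by auto
qed

text \<open>F(1 + f) and F'(1 + f)^2 are both dominated by multiples of f^2; the second makes F'(1 +
  f) a candidate for a test function in H^1.\<close>

lemma integrable_F:
  assumes "H1_pair f g" "\<And>x. \<bar>f x\<bar> \<le> 1/2"
  shows "integrable lborel (\<lambda>x. F (1 + f x))" "integrable lborel (\<lambda>x. (F' (1 + f x))\<^sup>2)"
proof -
  note D = H1_pairD[OF assms(1)]
  note [measurable] = borel_measurable_coefficients[OF D(6) assms(2)]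
  show "integrable lborel (\<lambda>x. F (1 + f x))"
  proof (rule Bochner_Integration.integrable_bound)
    show "integrable lborel (\<lambda>x. C * (f x)\<^sup>2)" using D by simp
    have "norm (F (1 + f x)) \<le> norm (C * (f x)\<^sup>2)" for x
    proof -
      have "0 \<le> c * (f x)\<^sup>2" using c_pos by simp
      with F_bounds[OF assms(2), of x] show ?thesis by simp
    qed
    then show "AE x in lborel. norm (F (1 + f x)) \<le> norm (C * (f x)\<^sup>2)"
      by simp
  qed measurable
  show "integrable lborel (\<lambda>x. (F' (1 + f x))\<^sup>2)"
  proof (rule Bochner_Integration.integrable_bound)
    show "integrable lborel (\<lambda>x. C\<^sup>2 * (f x)\<^sup>2)" using D by simp
    have "(F' (1 + f x))\<^sup>2 \<le> C\<^sup>2 * (f x)\<^sup>2" for x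
      using F'_bound[OF assms(2), of x] C_pos abs_le_square_iff[of "F' (1 + f x)" "C * f x"]
      by (simp add: abs_mult power_mult_distrib)
    then show "AE x in lborel. norm ((F' (1 + f x))\<^sup>2) \<le> norm (C\<^sup>2 * (f x)\<^sup>2)" by simp
  qed measurable
qed

lemma integrable_energy:
  assumes "H1_pair f g" "\<And>x. \<bar>f x\<bar> \<le> 1/2"
  shows "integrable lborel (\<lambda>x. p (1 + f x) * (g x)\<^sup>2)"
    "integrable lborel (\<lambda>x. p (1 + f x) * (g x)\<^sup>2 + F (1 + f x))"
proof -
  note D = H1_pairD[OF assms(1)]
  have "\<bar>p (1 + f x)\<bar> \<le> C" for x using p_bounds[OF in_range[OF assms(2)], of x] c_pos by simp
  then show *: "integrable lborel (\<lambda>x. p (1 + f x) * (g x)\<^sup>2)"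
    by (intro integrable_mult_bounded[OF D(3) borel_measurable_coefficients(1)[OF D(6) assms(2)]])
  show "integrable lborel (\<lambda>x. p (1 + f x) * (g x)\<^sup>2 + F (1 + f x))"
    by (intro Bochner_Integration.integrable_add * integrable_F(1)[OF assms])
qed

lemma energy_bounds:
  assumes "H1_pair f g" "\<And>x. \<bar>f x\<bar> \<le> 1/2"
  shows "c * (pair_norm f g)\<^sup>2 \<le> energy f g" "energy f g \<le> C * (pair_norm f g)\<^sup>2"
proof -
  note D = H1_pairD[OF assms(1)]
  have eq: "a * (pair_norm f g)\<^sup>2 = (LINT x|lborel. a * (g x)\<^sup>2 + a * (f x)\<^sup>2)" for a
    using D by (simp add: pair_norm_power2 algebra_simps)
  have le: "c * (g x)\<^sup>2 \<le> p (1 + f x) * (g x)\<^sup>2" "p (1 + f x) * (g x)\<^sup>2 \<le> C * (g x)\<^sup>2" for x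
    using p_bounds[OF in_range[OF assms(2)], of x] by (auto intro: mult_right_mono)
  show "c * (pair_norm f g)\<^sup>2 \<le> energy f g"
    unfolding eq energy_def using integrable_energy(2)[OF assms] D le F_bounds[OF assms(2)]
    by (intro integral_mono add_mono) simp_all
  show "energy f g \<le> C * (pair_norm f g)\<^sup>2"
    unfolding eq energy_def using integrable_energy(2)[OF assms] D le F_bounds[OF assms(2)]
    by (intro integral_mono add_mono) simp_all
qed

text \<open>The first term is cubic; h is taken out of it by the sup bound, which leaves the
  integrable g^2. In the other two terms a product of two square-integrable functions
  remains.\<close>

lemma integrable_energy_deriv:
  assumes fg: "H1_pair f g" "\<And>x. \<bar>f x\<bar> \<le> 1/2" and hk: "H1_pair h k"
  shows "integrable lborel (\<lambda>x. p' (1 + f x) * (g x)\<^sup>2 * h x)"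
    "integrable lborel (\<lambda>x. 2 * p (1 + f x) * g x * k x)"
    "integrable lborel (\<lambda>x. F' (1 + f x) * h x)"
proof -
  note D = H1_pairD[OF fg(1)] and E = H1_pairD[OF hk]
  note m = borel_measurable_coefficients[OF D(6) fg(2)]
  have "\<bar>h x * p' (1 + f x)\<bar> \<le> 2 * pair_norm h k * C" for x
    unfolding abs_mult using p'_bound[OF in_range[OF fg(2)]] H1_pair_sup_bound[OF hk]
    by (intro mult_mono) (auto simp: pair_norm_nonneg)
  then have "integrable lborel (\<lambda>x. h x * p' (1 + f x) * (g x)\<^sup>2)"
    by (rule integrable_mult_bounded[OF D(3), rotated]) (intro borel_measurable_times E m)
  then show "integrable lborel (\<lambda>x. p' (1 + f x) * (g x)\<^sup>2 * h x)"
    by (simp add: mult.assoc mult.commute mult.left_commute)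
  have "\<bar>p (1 + f x)\<bar> \<le> C" for x using p_bounds[OF in_range[OF fg(2)], of x] c_pos by simp
  from integrable_mult_bounded[OF integrable_mult_of_squares[OF D(5) E(5) D(3) E(3)] m(1) this]
  have "integrable lborel (\<lambda>x. 2 * (p (1 + f x) * (g x * k x)))" by (rule integrable_mult_right)
  then show "integrable lborel (\<lambda>x. 2 * p (1 + f x) * g x * k x)"
    by (simp add: mult.assoc)
  show "integrable lborel (\<lambda>x. F' (1 + f x) * h x)"
    using m E integrable_F[OF fg] by (intro integrable_mult_of_squares)
qed

lemma energy_deriv_linear:
  assumes fg: "H1_pair f g" "\<And>x. \<bar>f x\<bar> \<le> 1/2" and "H1_pair h k" "H1_pair h' k'"
  shows "energy_deriv f g (\<lambda>x. a * h x + b * h' x) (\<lambda>x. a * k x + b * k' x) =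
    a * energy_deriv f g h k + b * energy_deriv f g h' k'"
proof -
  note i = integrable_energy_deriv[OF fg assms(3)] and i' = integrable_energy_deriv[OF fg assms(4)]
  have "energy_deriv f g (\<lambda>x. a * h x + b * h' x) (\<lambda>x. a * k x + b * k' x) =
    (LINT x|lborel. a * (p' (1 + f x) * (g x)\<^sup>2 * h x + 2 * p (1 + f x) * g x * k x + F' (1 + f x) * h x)
      + b * (p' (1 + f x) * (g x)\<^sup>2 * h' x + 2 * p (1 + f x) * g x * k' x + F' (1 + f x) * h' x))"
    unfolding energy_deriv_def by (intro Bochner_Integration.integral_cong) (auto simp: algebra_simps)
  also have "\<dots> = a * energy_deriv f g h k + b * energy_deriv f g h' k'"
    unfolding energy_deriv_def
    using i i' by (subst Bochner_Integration.integral_add) (auto intro!: Bochner_Integration.integrable_add integrable_mult_right simp: integral_mult_right_zero)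
  finally show ?thesis .
qed

text \<open>With M the norm of (f, g), the cubic term costs 2 M^2 by the sup bound on h, the
  gradient term 2 M and the potential term M by Cauchy-Schwarz. The estimate serves to neglect the
  error of difference quotients inside the linear functional.\<close>

lemma energy_deriv_bound:
  assumes fg: "H1_pair f g" "\<And>x. \<bar>f x\<bar> \<le> 1/2" and hk: "H1_pair h k"
  shows "\<bar>energy_deriv f g h k\<bar> \<le> C * (2 * (pair_norm f g)\<^sup>2 + 3 * pair_norm f g) * pair_norm h k"
proof -
  note D = H1_pairD[OF fg(1)] and E = H1_pairD[OF hk]
  note i = integrable_energy_deriv[OF fg hk]
  let ?N = "pair_norm h k" and ?M = "pair_norm f g"
  have [measurable]: "f \<in> borel_measurable borel" "g \<in> borel_measurable borel" "h \<in> borel_measurable borel" "k \<in> borel_measurable borel"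
    using D E by auto
  have ii: "integrable lborel (\<lambda>x. \<bar>g x\<bar> * \<bar>k x\<bar>)" "integrable lborel (\<lambda>x. \<bar>f x\<bar> * \<bar>h x\<bar>)"
    using integrable_mult_of_squares[of g k] integrable_mult_of_squares[of f h] D E by (simp_all add: abs_mult[symmetric])
  have bound: "\<bar>p' (1 + f x) * (g x)\<^sup>2 * h x + 2 * p (1 + f x) * g x * k x + F' (1 + f x) * h x\<bar> \<le>
      C * (2 * ?N * (g x)\<^sup>2 + 2 * (\<bar>g x\<bar> * \<bar>k x\<bar>) + \<bar>f x\<bar> * \<bar>h x\<bar>)" for x
  proof -
    have "\<bar>p' (1 + f x)\<bar> * (\<bar>h x\<bar> * (g x)\<^sup>2) \<le> C * (2 * ?N * (g x)\<^sup>2)"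
      using p'_bound[OF in_range[OF fg(2)]] H1_pair_sup_bound[OF hk] C_pos
      by (intro mult_mono mult_right_mono) (auto simp: pair_norm_nonneg)
    moreover have "\<bar>p (1 + f x)\<bar> * (2 * (\<bar>g x\<bar> * \<bar>k x\<bar>)) \<le> C * (2 * (\<bar>g x\<bar> * \<bar>k x\<bar>))"
      using p_bounds[OF in_range[OF fg(2)], of x] c_pos by (intro mult_right_mono) auto
    moreover have "\<bar>F' (1 + f x)\<bar> * \<bar>h x\<bar> \<le> C * \<bar>f x\<bar> * \<bar>h x\<bar>"
      using F'_bound[OF fg(2), of x] by (intro mult_right_mono) auto
    moreover have "\<bar>p' (1 + f x) * (g x)\<^sup>2 * h x + 2 * p (1 + f x) * g x * k x + F' (1 + f x) * h x\<bar>
      \<le> \<bar>p' (1 + f x)\<bar> * (\<bar>h x\<bar> * (g x)\<^sup>2) + \<bar>p (1 + f x)\<bar> * (2 * (\<bar>g x\<bar> * \<bar>k x\<bar>)) + \<bar>F' (1 + f x)\<bar> * \<bar>h x\<bar>"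
      by (rule order_trans[OF abs_triangle_ineq], rule add_mono, rule order_trans[OF abs_triangle_ineq])
        (auto simp: abs_mult)
    ultimately show ?thesis unfolding distrib_left by (simp add: mult.assoc)
  qed
  have "\<bar>energy_deriv f g h k\<bar> \<le> (LINT x|lborel. \<bar>p' (1 + f x) * (g x)\<^sup>2 * h x + 2 * p (1 + f x) * g x * k x + F' (1 + f x) * h x\<bar>)"
    unfolding energy_deriv_def by (rule integral_abs_bound)
  also have "\<dots> \<le> (LINT x|lborel. C * (2 * ?N * (g x)\<^sup>2 + 2 * (\<bar>g x\<bar> * \<bar>k x\<bar>) + \<bar>f x\<bar> * \<bar>h x\<bar>))"
    using bound i ii D by (intro integral_mono integrable_abs Bochner_Integration.integrable_add integrable_mult_right) auto
  also have "\<dots> = C * (2 * ?N * (LINT x|lborel. (g x)\<^sup>2) + 2 * (LINT x|lborel. \<bar>g x\<bar> * \<bar>k x\<bar>) + (LINT x|lborel. \<bar>f x\<bar> * \<bar>h x\<bar>))"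
    using ii D by simp
  also have "\<dots> \<le> C * (2 * ?N * ?M\<^sup>2 + 2 * (?M * ?N) + ?M * ?N)"
  proof -
    have s: "sqrt (LINT x|lborel. (u x)\<^sup>2) \<le> pair_norm u v" "sqrt (LINT x|lborel. (v x)\<^sup>2) \<le> pair_norm u v" for u v
      by (simp_all add: pair_norm_def)
    have "(LINT x|lborel. \<bar>g x\<bar> * \<bar>k x\<bar>) \<le> ?M * ?N"
      using integral_mult_le_norms[of g k] D E s
      by (auto intro: order_trans[OF _ mult_mono] simp: pair_norm_nonneg)
    moreover have "(LINT x|lborel. \<bar>f x\<bar> * \<bar>h x\<bar>) \<le> ?M * ?N"
      using integral_mult_le_norms[of f h] D E s
      by (auto intro: order_trans[OF _ mult_mono] simp: pair_norm_nonneg)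
    moreover have "2 * ?N * (LINT x|lborel. (g x)\<^sup>2) \<le> 2 * ?N * ?M\<^sup>2"
      using pair_norm_component_le by (intro mult_left_mono) (auto simp: pair_norm_nonneg)
    ultimately show ?thesis using C_pos by (intro mult_left_mono) auto
  qed
  also have "\<dots> = C * (2 * ?M\<^sup>2 + 3 * ?M) * ?N" by (simp add: algebra_simps)
  finally show ?thesis .
qed

text \<open>Second-order Taylor expansion of p and F. The cross term, with the increment of p of
  first order in h and a factor k, is split by 2 |h v k| \<le> h^2 v^2 + k^2, so every piece is
  quadratic in (h, k).\<close>

lemma density_remainder:
  assumes "\<bar>u\<bar> \<le> 1/2" "\<bar>u + h\<bar> \<le> 1/2"
  shows "\<bar>p (1 + (u + h)) * (v + k)\<^sup>2 + F (1 + (u + h)) - (p (1 + u) * v\<^sup>2 + F (1 + u))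
      - (p' (1 + u) * v\<^sup>2 * h + 2 * p (1 + u) * v * k + F' (1 + u) * h)\<bar>
    \<le> C * (2 * (h\<^sup>2 * v\<^sup>2) + 2 * k\<^sup>2 + h\<^sup>2)"
proof -
  have r: "1 + u \<in> {1/2..3/2}" "1 + (u + h) \<in> {1/2..3/2}" using in_range assms by blast+
  obtain z where "z \<in> {1/2..3/2}" and z: "p (1 + (u + h)) = p (1 + u) + p' (1 + u) * h + p'' z / 2 * h\<^sup>2"
    using Taylor_2[OF p p' r] by auto
  then have 1: "\<bar>p'' z / 2\<bar> \<le> C" using p''_bound[of z] C_pos by simp
  obtain y where "y \<in> {1/2..3/2}" and y: "F (1 + (u + h)) = F (1 + u) + F' (1 + u) * h + F'' y / 2 * h\<^sup>2"
    using Taylor_2[OF F F' r] by auto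
  then have 2: "\<bar>F'' y / 2\<bar> \<le> C" using F''_bounds[of y] c_pos by simp
  have 3: "\<bar>p (1 + (u + h)) - p (1 + u)\<bar> \<le> C * \<bar>h\<bar>"
    using lipschitz_bound[OF p p'_bound r] by simp
  have 4: "\<bar>p (1 + (u + h))\<bar> \<le> C" using p_bounds[OF r(2)] c_pos by simp
  have "p (1 + (u + h)) * (v + k)\<^sup>2 + F (1 + (u + h)) - (p (1 + u) * v\<^sup>2 + F (1 + u))
      - (p' (1 + u) * v\<^sup>2 * h + 2 * p (1 + u) * v * k + F' (1 + u) * h) =
    (p (1 + (u + h)) - p (1 + u) - p' (1 + u) * h) * v\<^sup>2 + 2 * ((p (1 + (u + h)) - p (1 + u)) * (v * k))
      + p (1 + (u + h)) * k\<^sup>2 + (F (1 + (u + h)) - F (1 + u) - F' (1 + u) * h)"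
    by (simp add: algebra_simps power2_eq_square)
  also have "\<bar>\<dots>\<bar> \<le> \<bar>(p (1 + (u + h)) - p (1 + u) - p' (1 + u) * h) * v\<^sup>2\<bar> + \<bar>2 * ((p (1 + (u + h)) - p (1 + u)) * (v * k))\<bar>
      + \<bar>p (1 + (u + h)) * k\<^sup>2\<bar> + \<bar>F (1 + (u + h)) - F (1 + u) - F' (1 + u) * h\<bar>"
    by (meson abs_triangle_ineq add_mono order_refl order_trans)
  also have "\<dots> \<le> C * (h\<^sup>2 * v\<^sup>2) + C * (h\<^sup>2 * v\<^sup>2 + k\<^sup>2) + C * k\<^sup>2 + C * h\<^sup>2"
  proof (intro add_mono)
    show "\<bar>(p (1 + (u + h)) - p (1 + u) - p' (1 + u) * h) * v\<^sup>2\<bar> \<le> C * (h\<^sup>2 * v\<^sup>2)"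
      using mult_right_mono[OF 1, of "h\<^sup>2 * v\<^sup>2"] by (simp add: z abs_mult)
    have "2 * (\<bar>h\<bar> * (\<bar>v\<bar> * \<bar>k\<bar>)) \<le> h\<^sup>2 * v\<^sup>2 + k\<^sup>2"
      using sum_squares_bound[of "\<bar>h\<bar> * \<bar>v\<bar>" "\<bar>k\<bar>"] by (simp add: power_mult_distrib mult.assoc)
    then have "C * (2 * (\<bar>h\<bar> * (\<bar>v\<bar> * \<bar>k\<bar>))) \<le> C * (h\<^sup>2 * v\<^sup>2 + k\<^sup>2)" using C_pos by (intro mult_left_mono) auto
    moreover have "\<bar>p (1 + (u + h)) - p (1 + u)\<bar> * (\<bar>v\<bar> * \<bar>k\<bar>) \<le> C * \<bar>h\<bar> * (\<bar>v\<bar> * \<bar>k\<bar>)"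
      using 3 by (intro mult_right_mono) auto
    ultimately show "\<bar>2 * ((p (1 + (u + h)) - p (1 + u)) * (v * k))\<bar> \<le> C * (h\<^sup>2 * v\<^sup>2 + k\<^sup>2)"
      by (simp add: abs_mult mult.assoc)
    show "\<bar>p (1 + (u + h)) * k\<^sup>2\<bar> \<le> C * k\<^sup>2"
      using mult_right_mono[OF 4, of "k\<^sup>2"] by (simp add: abs_mult)
    show "\<bar>F (1 + (u + h)) - F (1 + u) - F' (1 + u) * h\<bar> \<le> C * h\<^sup>2"
      using mult_right_mono[OF 2, of "h\<^sup>2"] by (simp add: y abs_mult)
  qed
  finally show ?thesis by (simp add: algebra_simps)
qed

text \<open>The integrated pointwise remainder. The quartic term h^2 g^2 is controlled by h^2 \<le>
  4 N^2, N the norm of (h, k), which turns the coefficient 2 into 8.\<close>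

lemma energy_remainder:
  assumes fg: "H1_pair f g" "\<And>x. \<bar>f x\<bar> \<le> 1/2" and hk: "H1_pair h k" and fh: "\<And>x. \<bar>f x + h x\<bar> \<le> 1/2"
  shows "\<bar>energy (\<lambda>x. f x + h x) (\<lambda>x. g x + k x) - energy f g - energy_deriv f g h k\<bar>
    \<le> C * (8 * (pair_norm f g)\<^sup>2 + 2) * (pair_norm h k)\<^sup>2"
proof -
  note D = H1_pairD[OF fg(1)] and E = H1_pairD[OF hk]
  let ?N = "pair_norm h k" and ?M = "pair_norm f g"
  have fhgk: "H1_pair (\<lambda>x. f x + h x) (\<lambda>x. g x + k x)"
    using H1_pair_linear[OF fg(1) hk, of 1 1] by simp
  note i = integrable_energy_deriv[OF fg hk] integrable_energy(2)[OF fg] integrable_energy(2)[OF fhgk fh]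
  let ?R = "\<lambda>x. p (1 + (f x + h x)) * (g x + k x)\<^sup>2 + F (1 + (f x + h x)) - (p (1 + f x) * (g x)\<^sup>2 + F (1 + f x))
      - (p' (1 + f x) * (g x)\<^sup>2 * h x + 2 * p (1 + f x) * g x * k x + F' (1 + f x) * h x)"
  note d = Bochner_Integration.integrable_diff[OF i(5) i(4)]
    Bochner_Integration.integrable_add[OF Bochner_Integration.integrable_add[OF i(1) i(2)] i(3)]
  have R: "integrable lborel ?R"
    by (rule Bochner_Integration.integrable_diff[OF d])
  have eq: "energy (\<lambda>x. f x + h x) (\<lambda>x. g x + k x) - energy f g - energy_deriv f g h k = (LINT x|lborel. ?R x)"
    unfolding energy_def energy_deriv_def Bochner_Integration.integral_diff[OF d]
      Bochner_Integration.integral_diff[OF i(5) i(4)] ..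
  have "\<bar>energy (\<lambda>x. f x + h x) (\<lambda>x. g x + k x) - energy f g - energy_deriv f g h k\<bar> \<le> (LINT x|lborel. \<bar>?R x\<bar>)"
    unfolding eq by (rule integral_abs_bound)
  also have "\<dots> \<le> (LINT x|lborel. C * (8 * ?N\<^sup>2 * (g x)\<^sup>2 + 2 * (k x)\<^sup>2 + (h x)\<^sup>2))"
  proof (rule integral_mono[OF integrable_abs[OF R]])
    show "integrable lborel (\<lambda>x. C * (8 * ?N\<^sup>2 * (g x)\<^sup>2 + 2 * (k x)\<^sup>2 + (h x)\<^sup>2))"
      by (intro integrable_mult_right Bochner_Integration.integrable_add D E)
    fix x
    have "(h x)\<^sup>2 \<le> 4 * ?N\<^sup>2"
      using power_mono[OF H1_pair_sup_bound[OF hk, of x], of 2] by (simp add: power_mult_distrib)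
    then have "(h x)\<^sup>2 * (g x)\<^sup>2 \<le> 4 * ?N\<^sup>2 * (g x)\<^sup>2" by (rule mult_right_mono) simp
    then have "C * (2 * ((h x)\<^sup>2 * (g x)\<^sup>2) + 2 * (k x)\<^sup>2 + (h x)\<^sup>2) \<le> C * (8 * ?N\<^sup>2 * (g x)\<^sup>2 + 2 * (k x)\<^sup>2 + (h x)\<^sup>2)"
      using C_pos by (intro mult_left_mono) linarith+
    from order_trans[OF density_remainder[OF fg(2) fh, of x "g x" "k x"] this]
    show "\<bar>?R x\<bar> \<le> C * (8 * ?N\<^sup>2 * (g x)\<^sup>2 + 2 * (k x)\<^sup>2 + (h x)\<^sup>2)" .
  qed
  also have "\<dots> = C * (8 * ?N\<^sup>2 * (LINT x|lborel. (g x)\<^sup>2) + 2 * (LINT x|lborel. (k x)\<^sup>2) + (LINT x|lborel. (h x)\<^sup>2))"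
    using D E by simp
  also have "\<dots> \<le> C * (8 * ?N\<^sup>2 * ?M\<^sup>2 + 2 * ?N\<^sup>2)"
  proof (intro mult_left_mono)
    have "8 * ?N\<^sup>2 * (LINT x|lborel. (g x)\<^sup>2) \<le> 8 * ?N\<^sup>2 * ?M\<^sup>2"
      using pair_norm_component_le(2) by (intro mult_left_mono) auto
    moreover have "0 \<le> (LINT x|lborel. (h x)\<^sup>2)" by simp
    ultimately show "8 * ?N\<^sup>2 * (LINT x|lborel. (g x)\<^sup>2) + 2 * (LINT x|lborel. (k x)\<^sup>2) + (LINT x|lborel. (h x)\<^sup>2) \<le> 8 * ?N\<^sup>2 * ?M\<^sup>2 + 2 * ?N\<^sup>2"
      using pair_norm_power2[of h k] by linarith
  qed (use C_pos in simp)
  also have "\<dots> = C * (8 * ?M\<^sup>2 + 2) * ?N\<^sup>2" by (simp add: algebra_simps)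
  finally show ?thesis .
qed

text \<open>With \<tau> = s - t one has w s = w t + \<tau> (\<omega> + r s), where r s tends to 0 in
  H^1. The quadratic remainder divided by \<tau> is of order |\<tau>|, and the linear term
  contributes the derivative along \<omega> plus that along r s, which is at most L times the norm
  of r s.\<close>

lemma energy_has_derivative:
  assumes t: "t \<in> I"
    and w: "\<And>s. s \<in> I \<Longrightarrow> H1_pair (w s) (g s)" "\<And>s x. s \<in> I \<Longrightarrow> \<bar>w s x\<bar> \<le> 1/2"
    and \<omega>: "H1_pair \<omega> \<gamma>"
    and lim: "((\<lambda>s. pair_norm (\<lambda>x. (w s x - w t x) / (s - t) - \<omega> x) (\<lambda>x. (g s x - g t x) / (s - t) - \<gamma> x)) \<longlongrightarrow> 0) (at t within I)"
  shows "((\<lambda>s. energy (w s) (g s)) has_real_derivative energy_deriv (w t) (g t) \<omega> \<gamma>) (at t within I)"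
  unfolding has_field_derivative_iff
proof (rule LIM_zero_cancel, rule Lim_null_comparison)
  define r where "r s x = (w s x - w t x) / (s - t) - \<omega> x" for s x
  define \<rho> where "\<rho> s x = (g s x - g t x) / (s - t) - \<gamma> x" for s x
  define K where "K = C * (8 * (pair_norm (w t) (g t))\<^sup>2 + 2)"
  define L where "L = C * (2 * (pair_norm (w t) (g t))\<^sup>2 + 3 * pair_norm (w t) (g t))"
  let ?N = "\<lambda>s. pair_norm (r s) (\<rho> s)"
  have "K \<ge> 0" using C_pos by (simp add: K_def)
  have "(?N \<longlongrightarrow> 0) (at t within I)"
    using lim by (simp add: r_def[abs_def] \<rho>_def[abs_def])
  then have "((\<lambda>s. K * (\<bar>s - t\<bar> * (pair_norm \<omega> \<gamma> + ?N s)\<^sup>2) + L * ?N s) \<longlongrightarrow> K * (\<bar>t - t\<bar> * (pair_norm \<omega> \<gamma> + 0)\<^sup>2) + L * 0) (at t within I)"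
    by (intro tendsto_intros)
  then show "((\<lambda>s. K * (\<bar>s - t\<bar> * (pair_norm \<omega> \<gamma> + ?N s)\<^sup>2) + L * ?N s) \<longlongrightarrow> 0) (at t within I)"
    by simp
  show "\<forall>\<^sub>F s in at t within I. norm ((energy (w s) (g s) - energy (w t) (g t)) / (s - t) - energy_deriv (w t) (g t) \<omega> \<gamma>)
      \<le> K * (\<bar>s - t\<bar> * (pair_norm \<omega> \<gamma> + ?N s)\<^sup>2) + L * ?N s"
    unfolding eventually_at_filter
  proof (intro always_eventually allI impI)
    fix s assume s: "s \<noteq> t" "s \<in> I"
    define \<tau> where "\<tau> = s - t"
    have \<tau>: "\<tau> \<noteq> 0" using s by (simp add: \<tau>_def)
    have diff: "H1_pair (\<lambda>x. w s x - w t x) (\<lambda>x. g s x - g t x)"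
      using H1_pair_linear[OF w(1)[OF s(2)] w(1)[OF t], of 1 "-1"] by simp
    have r: "H1_pair (r s) (\<rho> s)"
      using H1_pair_linear[OF diff \<omega>, of "1 / \<tau>" "-1"] by (simp add: r_def[abs_def] \<rho>_def[abs_def] \<tau>_def)
    have sum: "H1_pair (\<lambda>x. \<omega> x + r s x) (\<lambda>x. \<gamma> x + \<rho> s x)"
      using H1_pair_linear[OF \<omega> r, of 1 1] by simp
    have ws: "w s = (\<lambda>x. w t x + \<tau> * (\<omega> x + r s x))" "g s = (\<lambda>x. g t x + \<tau> * (\<gamma> x + \<rho> s x))"
      using \<tau> by (auto simp: r_def \<rho>_def \<tau>_def fun_eq_iff)
    have h: "H1_pair (\<lambda>x. \<tau> * (\<omega> x + r s x)) (\<lambda>x. \<tau> * (\<gamma> x + \<rho> s x))"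
      using H1_pair_linear[OF sum sum, of \<tau> 0] by simp
    have rem: "\<bar>energy (w s) (g s) - energy (w t) (g t) - energy_deriv (w t) (g t) (\<lambda>x. \<tau> * (\<omega> x + r s x)) (\<lambda>x. \<tau> * (\<gamma> x + \<rho> s x))\<bar>
        \<le> K * (pair_norm (\<lambda>x. \<tau> * (\<omega> x + r s x)) (\<lambda>x. \<tau> * (\<gamma> x + \<rho> s x)))\<^sup>2"
      using energy_remainder[OF w(1)[OF t] w(2)[OF t] h] w(2)[OF s(2)] unfolding K_def ws by simp
    have deriv: "energy_deriv (w t) (g t) (\<lambda>x. \<tau> * (\<omega> x + r s x)) (\<lambda>x. \<tau> * (\<gamma> x + \<rho> s x)) =
        \<tau> * (energy_deriv (w t) (g t) \<omega> \<gamma> + energy_deriv (w t) (g t) (r s) (\<rho> s))"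
      using energy_deriv_linear[OF w(1)[OF t] w(2)[OF t] \<omega> r, of \<tau> \<tau>] by (simp add: algebra_simps)
    have scale: "pair_norm (\<lambda>x. \<tau> * (\<omega> x + r s x)) (\<lambda>x. \<tau> * (\<gamma> x + \<rho> s x)) = \<bar>\<tau>\<bar> * pair_norm (\<lambda>x. \<omega> x + r s x) (\<lambda>x. \<gamma> x + \<rho> s x)"
      by (rule pair_norm_scale)
    have "\<bar>energy (w s) (g s) - energy (w t) (g t) - \<tau> * (energy_deriv (w t) (g t) \<omega> \<gamma> + energy_deriv (w t) (g t) (r s) (\<rho> s))\<bar>
        \<le> K * (\<bar>\<tau>\<bar> * pair_norm (\<lambda>x. \<omega> x + r s x) (\<lambda>x. \<gamma> x + \<rho> s x))\<^sup>2"
      using rem unfolding deriv scale .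
    also have "\<dots> \<le> K * (\<bar>\<tau>\<bar> * (pair_norm \<omega> \<gamma> + ?N s))\<^sup>2"
      using pair_norm_triangle[OF \<omega> r] \<open>K \<ge> 0\<close> by (intro mult_left_mono power_mono) (auto simp: pair_norm_nonneg)
    also have "\<dots> = \<bar>\<tau>\<bar> * (K * (\<bar>\<tau>\<bar> * (pair_norm \<omega> \<gamma> + ?N s)\<^sup>2))"
      by (simp add: power2_eq_square algebra_simps)
    finally have \<tau>_bound: "\<bar>energy (w s) (g s) - energy (w t) (g t) - \<tau> * (energy_deriv (w t) (g t) \<omega> \<gamma> + energy_deriv (w t) (g t) (r s) (\<rho> s))\<bar>
        \<le> \<bar>\<tau>\<bar> * (K * (\<bar>\<tau>\<bar> * (pair_norm \<omega> \<gamma> + ?N s)\<^sup>2))" .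
    have "\<tau> * ((energy (w s) (g s) - energy (w t) (g t)) / \<tau> - energy_deriv (w t) (g t) \<omega> \<gamma> - energy_deriv (w t) (g t) (r s) (\<rho> s)) =
        energy (w s) (g s) - energy (w t) (g t) - \<tau> * (energy_deriv (w t) (g t) \<omega> \<gamma> + energy_deriv (w t) (g t) (r s) (\<rho> s))"
      using \<tau> by (simp add: right_diff_distrib distrib_left diff_divide_distrib)
    with \<tau>_bound have "\<bar>\<tau> * ((energy (w s) (g s) - energy (w t) (g t)) / \<tau> - energy_deriv (w t) (g t) \<omega> \<gamma> - energy_deriv (w t) (g t) (r s) (\<rho> s))\<bar>
        \<le> \<bar>\<tau>\<bar> * (K * (\<bar>\<tau>\<bar> * (pair_norm \<omega> \<gamma> + ?N s)\<^sup>2))"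
      by (simp only:)
    then have "\<bar>(energy (w s) (g s) - energy (w t) (g t)) / \<tau> - energy_deriv (w t) (g t) \<omega> \<gamma> - energy_deriv (w t) (g t) (r s) (\<rho> s)\<bar>
        \<le> K * (\<bar>\<tau>\<bar> * (pair_norm \<omega> \<gamma> + ?N s)\<^sup>2)"
      using \<tau> by (simp add: abs_mult)
    moreover have "\<bar>energy_deriv (w t) (g t) (r s) (\<rho> s)\<bar> \<le> L * ?N s"
      using energy_deriv_bound[OF w(1)[OF t] w(2)[OF t] r] by (simp add: L_def)
    ultimately show "norm ((energy (w s) (g s) - energy (w t) (g t)) / (s - t) - energy_deriv (w t) (g t) \<omega> \<gamma>)
      \<le> K * (\<bar>s - t\<bar> * (pair_norm \<omega> \<gamma> + ?N s)\<^sup>2) + L * ?N s"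
      unfolding \<tau>_def[symmetric] real_norm_def by linarith
  qed
qed

end

section \<open>Conservation of the energy and stability\<close>

text \<open>Normalized to vanish at 1, in the logarithmic case as well, so that later arguments need
  not distinguish exponents.\<close>

definition powr_primitive :: "real \<Rightarrow> real \<Rightarrow> real" where
  "powr_primitive a x = (if a = -1 then ln x else (x powr (a + 1) - 1) / (a + 1))"

lemma has_real_derivative_powr_primitive:
  assumes "x > 0"
  shows "(powr_primitive a has_real_derivative x powr a) (at x)"
proof (cases "a = -1")
  case True
  then have "powr_primitive a = ln" by (auto simp: powr_primitive_def fun_eq_iff)
  moreover have "(ln has_real_derivative x powr a) (at x)"
    using assms True by (auto intro!: derivative_eq_intros simp: powr_minus_divide)
  ultimately show ?thesis by simp
next
  case False
  then have eq: "powr_primitive a = (\<lambda>x. (x powr (a + 1) - 1) / (a + 1))" by (auto simp: powr_primitive_def fun_eq_iff)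
  have "a + 1 \<noteq> 0" using False by auto
  then show ?thesis
    unfolding eq using assms by (auto intro!: derivative_eq_intros)
qed

lemma powr_primitive_1: "powr_primitive a 1 = 0"
  by (simp add: powr_primitive_def)

text \<open>|ln x| \<le> ln 2 on the interval, a bound symmetric about 0 that serves both signs of
  r.\<close>

lemma powr_bounds:
  assumes "x \<in> {1/2..3/2::real}"
  shows "exp (- (\<bar>r\<bar> * ln 2)) \<le> x powr r" "x powr r \<le> exp (\<bar>r\<bar> * ln 2)"
proof -
  have "ln (1/2) \<le> ln x" "ln x \<le> ln 2" using assms by (auto simp: ln_le_cancel_iff)
  then have "\<bar>ln x\<bar> \<le> ln 2" by (simp add: ln_div)
  then have "\<bar>r * ln x\<bar> \<le> \<bar>r\<bar> * ln 2" by (simp add: abs_mult mult_left_mono)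
  moreover have "x powr r = exp (r * ln x)" using assms by (simp add: powr_def)
  ultimately show "exp (- (\<bar>r\<bar> * ln 2)) \<le> x powr r" "x powr r \<le> exp (\<bar>r\<bar> * ln 2)" by auto
qed

definition potential' :: "real \<Rightarrow> real \<Rightarrow> real \<Rightarrow> real" where
  "potential' n m = powr_primitive (- m - n)"

text \<open>Integration by parts: a primitive of F' is x F'(x) minus a primitive of x F''(x) =
  x^(1-m-n). Both parts vanish at 1.\<close>

definition potential :: "real \<Rightarrow> real \<Rightarrow> real \<Rightarrow> real" where
  "potential n m x = x * powr_primitive (- m - n) x - powr_primitive (- m - n + 1) x"

text \<open>Here p(\<phi>) \<phi>_z^2 is half the square of \<phi>^(-m) \<phi>_z, the quantity whose
  time derivative is u_z.\<close>

locale magma_energy =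
  energy_density "\<lambda>x. x powr (- 2 * m) / 2" "\<lambda>x. - m * x powr (- 2 * m - 1)"
    "\<lambda>x. m * (2 * m + 1) * x powr (- 2 * m - 2)"
    "potential n m" "potential' n m" "\<lambda>x. x powr (- m - n)" c C for n m c C

lemma magma_energy_exists: "\<exists>c C. magma_energy n m c C"
proof -
  define L where "L r = exp (- (\<bar>r\<bar> * ln 2))" for r :: real
  define U where "U r = exp (\<bar>r\<bar> * ln 2)" for r :: real
  \<comment> \<open>The first half is the factor 1/2 in p, the second comes from the requirement 2 c
    \<le> F''. In C the four upper bounds are simply added.\<close>
  define c where "c = min (L (- 2 * m) / 2) (L (- m - n) / 2)"
  define C where "C = U (- 2 * m) / 2 + U (- m - n) + \<bar>m\<bar> * U (- 2 * m - 1) + \<bar>m * (2 * m + 1)\<bar> * U (- 2 * m - 2)"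
  have LU: "0 < L r" "0 < U r" for r by (simp_all add: L_def U_def)
  have b: "L r \<le> z powr r" "z powr r \<le> U r" if "z \<in> {1/2..3/2}" for z r
    using powr_bounds[OF that] by (simp_all add: L_def U_def)
  have nonneg: "0 \<le> \<bar>q\<bar> * U r" for q r using LU[of r] by simp
  have "magma_energy n m c C"
  proof (unfold_locales)
    fix z :: real assume z: "z \<in> {1/2..3/2}"
    then have "z > 0" by simp
    show "((\<lambda>x. x powr (- 2 * m) / 2) has_real_derivative - m * z powr (- 2 * m - 1)) (at z)"
      using \<open>z > 0\<close> by (auto intro!: derivative_eq_intros)
    show "((\<lambda>x. - m * x powr (- 2 * m - 1)) has_real_derivative m * (2 * m + 1) * z powr (- 2 * m - 2)) (at z)"
      using \<open>z > 0\<close> by (auto intro!: derivative_eq_intros simp: algebra_simps)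
    show "(potential' n m has_real_derivative z powr (- m - n)) (at z)"
      unfolding potential'_def by (rule has_real_derivative_powr_primitive[OF \<open>z > 0\<close>])
    have "z * z powr (- m - n) = z powr (- m - n + 1)"
      using \<open>z > 0\<close> by (simp add: powr_add)
    then show "(potential n m has_real_derivative potential' n m z) (at z)"
      unfolding potential_def[abs_def] potential'_def using \<open>z > 0\<close>
      by (auto intro!: derivative_eq_intros has_real_derivative_powr_primitive simp: mult.commute)
    show "c \<le> z powr (- 2 * m) / 2 \<and> z powr (- 2 * m) / 2 \<le> C"
      using b[OF z, of "- 2 * m"] LU[of "- m - n"] nonneg[of m "- 2 * m - 1"] nonneg[of "m * (2 * m + 1)" "- 2 * m - 2"]
      unfolding c_def C_def by linarith
    show "2 * c \<le> z powr (- m - n) \<and> z powr (- m - n) \<le> C"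
      using b[OF z, of "- m - n"] LU[of "- 2 * m"] nonneg[of m "- 2 * m - 1"] nonneg[of "m * (2 * m + 1)" "- 2 * m - 2"]
      unfolding c_def C_def by linarith
    have "\<bar>- m * z powr (- 2 * m - 1)\<bar> \<le> \<bar>m\<bar> * U (- 2 * m - 1)"
      using b(2)[OF z, of "- 2 * m - 1"] by (simp add: abs_mult mult_left_mono)
    then show "\<bar>- m * z powr (- 2 * m - 1)\<bar> \<le> C"
      using LU[of "- 2 * m"] LU[of "- m - n"] nonneg[of "m * (2 * m + 1)" "- 2 * m - 2"] unfolding C_def by linarith
    have "\<bar>m * (2 * m + 1) * z powr (- 2 * m - 2)\<bar> \<le> \<bar>m * (2 * m + 1)\<bar> * U (- 2 * m - 2)"
      using mult_left_mono[OF b(2)[OF z, of "- 2 * m - 2"], of "\<bar>m * (2 * m + 1)\<bar>"] by (simp add: abs_mult)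
    then show "\<bar>m * (2 * m + 1) * z powr (- 2 * m - 2)\<bar> \<le> C"
      using LU[of "- 2 * m"] LU[of "- m - n"] nonneg[of m "- 2 * m - 1"] unfolding C_def by linarith
  next
    show "potential n m 1 = 0" "potential' n m 1 = 0"
      by (simp_all add: potential_def potential'_def powr_primitive_1)
    show "0 < c" using LU by (simp add: c_def)
  qed
  then show ?thesis by blast
qed

lemma is_primitive_powr:
  assumes "is_primitive f g" "\<And>x. 0 < f x"
  shows "is_primitive (\<lambda>x. f x powr r) (\<lambda>x. r * f x powr (r - 1) * g x)"
  by (rule is_primitive_compose[where S = "{0<..}"])
    (use assms in \<open>auto intro!: derivative_eq_intros continuous_intros is_interval_oi\<close>)

section \<open>Vanishing of the energy derivative along solutions\<close>

context magma_energy
begin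

text \<open>F'(\<phi>) is an admissible test function: it vanishes at \<phi> = 1 and is Lipschitz
  there, so it is dominated by a multiple of |f|, and its derivative is a bounded multiple of
  g.\<close>

lemma H1_pair_potential':
  assumes fg: "H1_pair f g" "\<And>x. \<bar>f x\<bar> \<le> 1/2"
  shows "H1_pair (\<lambda>x. potential' n m (1 + f x)) (\<lambda>x. (1 + f x) powr (- m - n) * g x)"
proof -
  note D = H1_pairD[OF fg(1)]
  have f1: "is_primitive (\<lambda>x. 1 + f x) g" using is_primitive_shift[OF D(1), of 1] by (simp add: add.commute)
  have [measurable]: "f \<in> borel_measurable borel" "g \<in> borel_measurable borel" using D by auto
  have "is_primitive (\<lambda>x. potential' n m (1 + f x)) (\<lambda>x. (1 + f x) powr (- m - n) * g x)"
    by (rule is_primitive_compose[OF f1 F', where S = "{1/2..3/2}"])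
      (use in_range[OF fg(2)] in \<open>auto intro!: continuous_intros simp: is_interval_cc\<close>)
  moreover have "integrable lborel (\<lambda>x. ((1 + f x) powr (- m - n))\<^sup>2 * (g x)\<^sup>2)"
  proof (rule integrable_mult_bounded[OF D(3), of _ "C\<^sup>2"])
    fix x
    have "0 \<le> (1 + f x) powr (- m - n)" "(1 + f x) powr (- m - n) \<le> C"
      using F''_bounds[OF in_range[OF fg(2)], of x] by auto
    then show "\<bar>((1 + f x) powr (- m - n))\<^sup>2\<bar> \<le> C\<^sup>2" by (simp add: power_mono)
  qed measurable
  ultimately show ?thesis
    using integrable_F(2)[OF fg] by (simp add: H1_pair_def power_mult_distrib)
qed

text \<open>The integrand is the derivative of K(\<phi>) for a function K of one variable, and
  \<phi> tends to 1 at both ends of the line.\<close>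

lemma integral_flux_eq_0:
  assumes fg: "H1_pair f g" "\<And>x. \<bar>f x\<bar> \<le> 1/2"
  shows "(LINT x|lborel. n * (1 + f x) powr (n - 1) * g x * potential' n m (1 + f x)) = 0"
proof (rule integral_derivative_eq_0)
  note D = H1_pairD[OF fg(1)]
  have f1: "is_primitive (\<lambda>x. 1 + f x) g" using is_primitive_shift[OF D(1), of 1] by (simp add: add.commute)
  \<comment> \<open>A primitive of (x^n)' F'(x), found by parts from x^n F''(x) = x^(-m).\<close>
  define K where "K x = x powr n * potential' n m x - powr_primitive (- m) x" for x
  have K: "(K has_real_derivative n * x powr (n - 1) * potential' n m x) (at x)" if "x \<in> {1/2..3/2}" for x
  proof -
    have "x > 0" using that by simp
    then have "x powr n * x powr (- m - n) = x powr (- m)" by (simp add: powr_add[symmetric])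
    with \<open>x > 0\<close> show ?thesis
      unfolding K_def[abs_def] potential'_def
      by (auto intro!: derivative_eq_intros has_real_derivative_powr_primitive simp: mult.commute)
  qed
  have F'c: "continuous_on {1/2..3/2} (potential' n m)"
    using F' by (meson DERIV_isCont continuous_at_imp_continuous_on)
  have "is_primitive (\<lambda>x. K (1 + f x)) (\<lambda>x. n * (1 + f x) powr (n - 1) * potential' n m (1 + f x) * g x)"
    by (rule is_primitive_compose[OF f1 K, where S = "{1/2..3/2}"])
      (use in_range[OF fg(2)] F'c in \<open>auto intro!: continuous_intros simp: is_interval_cc\<close>)
  then show "is_primitive (\<lambda>x. K (1 + f x)) (\<lambda>x. n * (1 + f x) powr (n - 1) * g x * potential' n m (1 + f x))"
    by (simp add: mult_ac)
  have [measurable]: "f \<in> borel_measurable borel" using D by auto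
  have "integrable lborel (\<lambda>x. (n * (1 + f x) powr (n - 1)) * (g x * potential' n m (1 + f x)))"
  proof (rule integrable_mult_bounded)
    show "integrable lborel (\<lambda>x. g x * potential' n m (1 + f x))"
      by (rule integrable_mult_of_squares[OF D(5) borel_measurable_coefficients(4)[OF D(6) fg(2)] D(3) integrable_F(2)[OF fg]])
    show "\<bar>n * (1 + f x) powr (n - 1)\<bar> \<le> \<bar>n\<bar> * exp (\<bar>n - 1\<bar> * ln 2)" for x
      using powr_bounds(2)[OF in_range[OF fg(2)], of x "n - 1"] by (simp add: abs_mult mult_left_mono)
  qed measurable
  then show "integrable lborel (\<lambda>x. n * (1 + f x) powr (n - 1) * g x * potential' n m (1 + f x))"
    by (simp add: mult.assoc)
  have lim: "(\<lambda>i. K (1 + f (X i))) \<longlonglongrightarrow> K 1" if "(\<lambda>i. f (X i)) \<longlonglongrightarrow> 0" for X :: "nat \<Rightarrow> real"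
  proof (rule isCont_tendsto_compose[where g = K])
    show "isCont K 1" using K[of 1] by (auto intro: DERIV_isCont)
    show "(\<lambda>i. 1 + f (X i)) \<longlonglongrightarrow> 1" using tendsto_add[OF tendsto_const that, of 1] by simp
  qed
  show "(\<lambda>i. K (1 + f (real i))) \<longlonglongrightarrow> K 1" "(\<lambda>i. K (1 + f (- real i))) \<longlonglongrightarrow> K 1"
    using H1_pair_decay[OF fg(1)] by (auto intro: lim)
qed

text \<open>
  The energy is tested against \<open>\<phi>\<^sub>t = \<phi>\<^sup>m u\<close>, and the elliptic equation against \<open>F'(\<phi>)\<close>:
  the choice of \<open>F''\<close> makes the two expressions agree.
\<close>

lemma energy_deriv_eq_0:
  assumes fg: "H1_pair f g" "\<And>x. \<bar>f x\<bar> \<le> 1/2"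
    and u: "elliptic_weak_solution n m (\<lambda>x. 1 + f x) u" "continuous_on UNIV u"
    and \<omega>: "H1_pair \<omega> \<gamma>" "\<And>x. \<omega> x = (1 + f x) powr m * u x"
  shows "energy_deriv f g \<omega> \<gamma> = 0"
proof -
  note D = H1_pairD[OF fg(1)]
  define v where "v = weak_derivative 1 u"
  have uv: "H1_pair u v"
    using u unfolding v_def by (intro sobolev_1_continuous_imp_H1_pair) (auto simp: elliptic_weak_solution_def)
  note E = H1_pairD[OF uv]
  have pos: "0 < 1 + f x" for x using in_range[OF fg(2), of x] by simp
  have f1: "is_primitive (\<lambda>x. 1 + f x) g" using is_primitive_shift[OF D(1), of 1] by (simp add: add.commute)
  define \<psi> where "\<psi> x = potential' n m (1 + f x)" for x
  have \<psi>: "H1_pair \<psi> (\<lambda>x. (1 + f x) powr (- m - n) * g x)"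
    unfolding \<psi>_def[abs_def] by (rule H1_pair_potential'[OF fg])
  note \<psi>s = sobolev_1_if_H1_pair[OF \<psi> _ H1_pairD(4)[OF \<psi>]]
  have \<psi>': "\<psi> \<in> sobolev 1" "AE x in lborel. weak_derivative 1 \<psi> x = (1 + f x) powr (- m - n) * g x"
    using \<psi>s by auto
  have [measurable]: "f \<in> borel_measurable borel" "g \<in> borel_measurable borel" "u \<in> borel_measurable borel"
    "v \<in> borel_measurable borel" "\<omega> \<in> borel_measurable borel" "\<gamma> \<in> borel_measurable borel" "\<psi> \<in> borel_measurable borel"
    using D E H1_pairD[OF \<omega>(1)] H1_pairD[OF \<psi>] by auto
  have [measurable]: "weak_derivative 1 \<psi> \<in> borel_measurable borel"
    using weak_derivative_AE(1)[OF has_weak_derivative_if_is_primitive[OF H1_pairD(1)[OF \<psi>]]]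
    by (rule has_weak_derivative_measurable)
  have wdn: "has_weak_derivative 1 (\<lambda>x. (1 + f x) powr n) (\<lambda>x. n * (1 + f x) powr (n - 1) * g x)"
    by (intro has_weak_derivative_if_is_primitive is_primitive_powr f1 pos)
  have [measurable]: "weak_derivative 1 (\<lambda>x. (1 + f x) powr n) \<in> borel_measurable borel"
    by (rule has_weak_derivative_measurable[OF weak_derivative_AE(1)[OF wdn]])
  have \<omega>_eq: "\<omega> = (\<lambda>x. (1 + f x) powr m * u x)" using \<omega>(2) by auto
  \<comment> \<open>\<open>\<gamma>\<close> is just some derivative of \<open>\<omega>\<close>;
    uniqueness identifies it almost everywhere with the one given by the product rule for \<phi>^m
    u.\<close>
  have "is_primitive \<omega> (\<lambda>x. (1 + f x) powr m * v x + m * (1 + f x) powr (m - 1) * g x * u x)"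
    unfolding \<omega>_eq by (intro is_primitive_mult is_primitive_powr f1 pos E)
  then have \<gamma>: "AE x in lborel. \<gamma> x = (1 + f x) powr m * v x + m * (1 + f x) powr (m - 1) * g x * u x"
    by (intro is_primitive_unique[OF H1_pairD(1)[OF \<omega>(1)]])
  have "energy_deriv f g \<omega> \<gamma> = (LINT x|lborel. (1 + f x) powr n * v x * weak_derivative 1 \<psi> x + (1 + f x) powr m * u x * \<psi> x)"
    unfolding energy_deriv_def
  proof (rule integral_cong_AE)
    show "(\<lambda>x. - m * (1 + f x) powr (- 2 * m - 1) * (g x)\<^sup>2 * \<omega> x +
        2 * ((1 + f x) powr (- 2 * m) / 2) * g x * \<gamma> x + potential' n m (1 + f x) * \<omega> x) \<in> borel_measurable lborel"
      unfolding \<psi>_def[symmetric] by measurable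
    show "(\<lambda>x. (1 + f x) powr n * v x * weak_derivative 1 \<psi> x + (1 + f x) powr m * u x * \<psi> x) \<in> borel_measurable lborel"
      by measurable
    show "AE x in lborel. - m * (1 + f x) powr (- 2 * m - 1) * (g x)\<^sup>2 * \<omega> x +
        2 * ((1 + f x) powr (- 2 * m) / 2) * g x * \<gamma> x + potential' n m (1 + f x) * \<omega> x =
        (1 + f x) powr n * v x * weak_derivative 1 \<psi> x + (1 + f x) powr m * u x * \<psi> x"
      using \<gamma> \<psi>'(2)
    proof eventually_elim
      case (elim x)
      define X where "X = 1 + f x"
      have "X > 0" using pos by (simp add: X_def)
      have e: "X powr (- 2 * m - 1) * X powr m = X powr (- m - 1)" "X powr (- 2 * m) * X powr m = X powr (- m)"
        "X powr (- 2 * m) * X powr (m - 1) = X powr (- m - 1)" "X powr n * X powr (- m - n) = X powr (- m)"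
        by (simp_all add: powr_add[symmetric])
      \<comment> \<open>The terms in g^2 u cancel: the derivative of p is compensated by that of the
        factor \<phi>^m in \<omega>. What remains is \<phi>^(-m) \<phi>_z u_z, with \<phi>^(-m) then
        split as \<phi>^n \<phi>^(-m-n) to match the weak equation.\<close>
      have "- m * X powr (- 2 * m - 1) * (g x)\<^sup>2 * (X powr m * u x) +
          2 * (X powr (- 2 * m) / 2) * g x * (X powr m * v x + m * X powr (m - 1) * g x * u x) =
        - m * (X powr (- 2 * m - 1) * X powr m) * (g x)\<^sup>2 * u x + (X powr (- 2 * m) * X powr m) * g x * v x
          + m * (X powr (- 2 * m) * X powr (m - 1)) * (g x)\<^sup>2 * u x"
        by (simp add: algebra_simps power2_eq_square)
      also have "\<dots> = (X powr n * X powr (- m - n)) * g x * v x"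
        unfolding e by simp
      finally show ?case
        unfolding elim \<omega>(2) \<psi>_def X_def[symmetric] by (simp add: mult_ac)
    qed
  qed
  also have "\<dots> = - (LINT x|lborel. weak_derivative 1 (\<lambda>y. (1 + f y) powr n) x * \<psi> x)"
    using u(1) \<psi>'(1) unfolding elliptic_weak_solution_def v_def by blast
  also have "(LINT x|lborel. weak_derivative 1 (\<lambda>y. (1 + f y) powr n) x * \<psi> x) =
      (LINT x|lborel. n * (1 + f x) powr (n - 1) * g x * potential' n m (1 + f x))"
  proof (rule integral_cong_AE)
    show "AE x in lborel. weak_derivative 1 (\<lambda>y. (1 + f y) powr n) x * \<psi> x =
        n * (1 + f x) powr (n - 1) * g x * potential' n m (1 + f x)"
      using weak_derivative_AE(2)[OF wdn] by eventually_elim (simp add: \<psi>_def)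
    show "(\<lambda>x. n * (1 + f x) powr (n - 1) * g x * potential' n m (1 + f x)) \<in> borel_measurable lborel"
      unfolding \<psi>_def[symmetric] by measurable
  qed measurable
  also have "\<dots> = 0" by (rule integral_flux_eq_0[OF fg])
  finally show ?thesis by simp
qed

end

section \<open>Time derivative and integral equation\<close>

lemma negligible_if_integrals_zero_on:
  fixes f :: "real \<Rightarrow> real"
  assumes "\<And>x y. a \<le> x \<Longrightarrow> x \<le> y \<Longrightarrow> y \<le> b \<Longrightarrow> (f has_integral 0) {x..y}"
  shows "negligible {x \<in> {a..b}. f x \<noteq> 0}"
proof -
  define h where "h x = (if x \<in> {a..b} then f x else 0)" for x
  have "(h has_integral 0) {x..y}" for x y
  proof -
    have "(f has_integral 0) ({a..b} \<inter> {x..y})"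
      using assms[of "max a x" "min b y"] by (cases "max a x \<le> min b y") auto
    then show ?thesis unfolding h_def[abs_def] has_integral_restrict_Int .
  qed
  then have "negligible {x. h x \<noteq> 0}" by (rule negligible_if_integrals_zero)
  moreover have "{x. h x \<noteq> 0} = {x \<in> {a..b}. f x \<noteq> 0}" by (auto simp: h_def)
  ultimately show ?thesis by simp
qed

lemma continuous_eq_if_eq_on_Rats:
  fixes f g :: "real \<Rightarrow> real"
  assumes "continuous_on UNIV f" "continuous_on UNIV g" "\<And>x. x \<in> \<rat> \<Longrightarrow> f x = g x"
  shows "f x = g x"
proof -
  have "closed {x. f x = g x}" using assms by (intro closed_Collect_eq)
  then have "closure \<rat> \<subseteq> {x. f x = g x}" using assms(3) by (intro closure_minimal) auto
  then show ?thesis by (auto simp: Rats_closure_real)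
qed

text \<open>
  The integral equation holds in the Henstock--Kurzweil sense for each \<open>z\<close>, so \<open>\<omega> s z\<close> and
  \<open>h s z\<close> agree for \<open>s\<close> outside a null set depending on \<open>z\<close>; continuity in \<open>z\<close> reduces to
  countably many \<open>z\<close>.
\<close>

lemma derivative_eq_integrand_ae:
  fixes w \<omega> h :: "real \<Rightarrow> real \<Rightarrow> real"
  assumes D: "\<And>t z. t \<in> {0..\<tau>} \<Longrightarrow> ((\<lambda>s. w s z) has_real_derivative \<omega> t z) (at t within {0..\<tau>})"
    and h: "\<And>t z. t \<in> {0..\<tau>} \<Longrightarrow> ((\<lambda>s. h s z) has_integral (w t z - a z)) {0..t}"
    and cont: "\<And>t. t \<in> {0..\<tau>} \<Longrightarrow> continuous_on UNIV (\<omega> t)" "\<And>t. t \<in> {0..\<tau>} \<Longrightarrow> continuous_on UNIV (h t)"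
  shows "negligible {t \<in> {0..\<tau>}. \<exists>z. \<omega> t z \<noteq> h t z}"
proof -
  have "negligible {t \<in> {0..\<tau>}. \<omega> t z - h t z \<noteq> 0}" for z
  proof (rule negligible_if_integrals_zero_on)
    fix x y assume xy: "0 \<le> x" "x \<le> y" "y \<le> \<tau>"
    have "((\<lambda>t. \<omega> t z) has_integral (w y z - w x z)) {x..y}"
      using xy by (intro fundamental_theorem_of_calculus)
        (auto simp: has_real_derivative_iff_has_vector_derivative[symmetric] intro!: DERIV_subset[OF D])
    \<comment> \<open>Subtracting the integrals up to x and up to y removes the initial value
      \<open>a z\<close>.\<close>
    moreover have "((\<lambda>t. h t z) has_integral (w y z - w x z)) {x..y}"
    proof -
      have hy: "((\<lambda>s. h s z) has_integral (w y z - a z)) {0..y}" and hx: "((\<lambda>s. h s z) has_integral (w x z - a z)) {0..x}"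
        using xy by (auto intro!: h)
      have i: "(\<lambda>s. h s z) integrable_on {x..y}"
        using hy xy by (auto intro: integrable_on_subinterval)
      have "((\<lambda>s. h s z) has_integral (w x z - a z) + integral {x..y} (\<lambda>s. h s z)) {0..y}"
        using xy by (intro has_integral_combine[OF _ _ hx integrable_integral[OF i]]) auto
      with hy have "w y z - a z = (w x z - a z) + integral {x..y} (\<lambda>s. h s z)"
        by (rule has_integral_unique)
      with i show ?thesis by (simp add: has_integral_iff)
    qed
    ultimately have "((\<lambda>t. \<omega> t z - h t z) has_integral (w y z - w x z) - (w y z - w x z)) {x..y}"
      by (rule has_integral_diff)
    then show "((\<lambda>t. \<omega> t z - h t z) has_integral 0) {x..y}" by simp
  qed
  then have "negligible (\<Union>z\<in>\<rat>. {t \<in> {0..\<tau>}. \<omega> t z - h t z \<noteq> 0})"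
    by (intro negligible_countable_Union countable_image countable_rat) auto
  moreover have "{t \<in> {0..\<tau>}. \<exists>z. \<omega> t z \<noteq> h t z} \<subseteq> (\<Union>z\<in>\<rat>. {t \<in> {0..\<tau>}. \<omega> t z - h t z \<noteq> 0})"
  proof clarify
    fix t z assume t: "t \<in> {0..\<tau>}" and "\<omega> t z \<noteq> h t z"
    then obtain z' where "z' \<in> \<rat>" "\<omega> t z' \<noteq> h t z'"
      using continuous_eq_if_eq_on_Rats[OF cont[OF t]] by blast
    with t show "t \<in> (\<Union>z\<in>\<rat>. {t \<in> {0..\<tau>}. \<omega> t z - h t z \<noteq> 0})" by auto
  qed
  ultimately show ?thesis by (rule negligible_subset)
qed

text \<open>The derivative of the curve is given up to null sets at each time; its continuous
  representative \<open>\<omega> t\<close> replaces it and leaves the norms unchanged. The norm of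
  order k dominates that of order one, so convergence in H^1 is what is passed on.\<close>

lemma sobolev_C1_H1_derivative:
  assumes C1: "sobolev_C1_on k I w" and k: "1 \<le> k"
    and w: "\<And>t. t \<in> I \<Longrightarrow> H1_pair (w t) (g t)"
  obtains \<omega> \<gamma> where "\<And>t. t \<in> I \<Longrightarrow> H1_pair (\<omega> t) (\<gamma> t)"
    "\<And>t. t \<in> I \<Longrightarrow> ((\<lambda>s. pair_norm (\<lambda>x. (w s x - w t x) / (s - t) - \<omega> t x)
        (\<lambda>x. (g s x - g t x) / (s - t) - \<gamma> t x)) \<longlongrightarrow> 0) (at t within I)"
proof -
  obtain w' where w': "\<And>t. t \<in> I \<Longrightarrow> w' t \<in> sobolev k"
    and lim: "\<And>t. t \<in> I \<Longrightarrow> ((\<lambda>s. sobolev_norm k (\<lambda>z. (w s z - w t z) / (s - t) - w' t z)) \<longlongrightarrow> 0) (at t within I)"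
    using C1 unfolding sobolev_C1_on_def sobolev_continuous_on_def by blast
  have "\<exists>f. (AE x in lborel. w' t x = f x) \<and> H1_pair f (weak_derivative 1 (w' t))" if "t \<in> I" for t
    using sobolev_1_imp_H1_pair[of "w' t"] w'[OF that] sobolev_mono[OF k] by blast
  then obtain \<omega> where \<omega>: "\<And>t. t \<in> I \<Longrightarrow> AE x in lborel. w' t x = \<omega> t x"
    "\<And>t. t \<in> I \<Longrightarrow> H1_pair (\<omega> t) (weak_derivative 1 (w' t))" by metis
  define \<gamma> where "\<gamma> t = weak_derivative 1 (w' t)" for t
  show ?thesis
  proof (rule that[of \<omega> \<gamma>])
    fix t assume t: "t \<in> I"
    show \<omega>t: "H1_pair (\<omega> t) (\<gamma> t)" using \<omega>(2)[OF t] by (simp add: \<gamma>_def)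
    show "((\<lambda>s. pair_norm (\<lambda>x. (w s x - w t x) / (s - t) - \<omega> t x)
        (\<lambda>x. (g s x - g t x) / (s - t) - \<gamma> t x)) \<longlongrightarrow> 0) (at t within I)"
    proof (rule Lim_null_comparison[OF _ lim[OF t]])
      show "\<forall>\<^sub>F s in at t within I. norm (pair_norm (\<lambda>x. (w s x - w t x) / (s - t) - \<omega> t x)
        (\<lambda>x. (g s x - g t x) / (s - t) - \<gamma> t x)) \<le> sobolev_norm k (\<lambda>z. (w s z - w t z) / (s - t) - w' t z)"
        unfolding eventually_at_filter
      proof (intro always_eventually allI impI)
        fix s assume s: "s \<in> I"
        have d: "H1_pair (\<lambda>x. w s x - w t x) (\<lambda>x. g s x - g t x)"
          using H1_pair_linear[OF w[OF s] w[OF t], of 1 "-1"] by simp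
        have q: "H1_pair (\<lambda>x. (w s x - w t x) / (s - t) - \<omega> t x) (\<lambda>x. (g s x - g t x) / (s - t) - \<gamma> t x)"
          using H1_pair_linear[OF d \<omega>t, of "1 / (s - t)" "-1"] by simp
        have ae: "AE x in lborel. (w s x - w t x) / (s - t) - w' t x = (w s x - w t x) / (s - t) - \<omega> t x"
          using \<omega>(1)[OF t] by eventually_elim simp
        have [measurable]: "w' t \<in> borel_measurable borel" "w s \<in> borel_measurable borel" "w t \<in> borel_measurable borel"
          using w'[OF t] H1_pairD(4)[OF w[OF s]] H1_pairD(4)[OF w[OF t]] by (auto simp: sobolev_def square_integrable_def)
        have "(\<lambda>x. (w s x - w t x) / (s - t) - w' t x) \<in> borel_measurable borel" by measurable
        from sobolev_1_if_H1_pair(2)[OF q ae this] sobolev_norm_mono[OF k, of "\<lambda>x. (w s x - w t x) / (s - t) - w' t x"]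
        show "norm (pair_norm (\<lambda>x. (w s x - w t x) / (s - t) - \<omega> t x) (\<lambda>x. (g s x - g t x) / (s - t) - \<gamma> t x))
          \<le> sobolev_norm k (\<lambda>z. (w s z - w t z) / (s - t) - w' t z)"
          unfolding real_norm_def abs_of_nonneg[OF pair_norm_nonneg] by simp
      qed
    qed
  qed
qed

text \<open>The reverse triangle inequality, with the norm of order k dominating that of order
  one.\<close>

lemma pair_norm_continuous:
  assumes cont: "sobolev_continuous_on k I w" and k: "1 \<le> k"
    and w: "\<And>t. t \<in> I \<Longrightarrow> H1_pair (w t) (g t)"
  shows "continuous_on I (\<lambda>t. pair_norm (w t) (g t))"
  unfolding continuous_on_def
proof
  fix t assume t: "t \<in> I"
  have lim: "((\<lambda>s. sobolev_norm k (\<lambda>z. w s z - w t z)) \<longlongrightarrow> 0) (at t within I)"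
    using cont t by (simp add: sobolev_continuous_on_def)
  show "((\<lambda>t. pair_norm (w t) (g t)) \<longlongrightarrow> pair_norm (w t) (g t)) (at t within I)"
  proof (rule LIM_zero_cancel, rule Lim_null_comparison[OF _ lim])
    show "\<forall>\<^sub>F s in at t within I. norm (pair_norm (w s) (g s) - pair_norm (w t) (g t)) \<le> sobolev_norm k (\<lambda>z. w s z - w t z)"
      unfolding eventually_at_filter
    proof (intro always_eventually allI impI)
      fix s assume s: "s \<in> I"
      have d: "H1_pair (\<lambda>x. w s x - w t x) (\<lambda>x. g s x - g t x)"
        using H1_pair_linear[OF w[OF s] w[OF t], of 1 "-1"] by simp
      have d': "H1_pair (\<lambda>x. w t x - w s x) (\<lambda>x. g t x - g s x)"
        using H1_pair_linear[OF w[OF t] w[OF s], of 1 "-1"] by simp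
      have sym: "pair_norm (\<lambda>x. w t x - w s x) (\<lambda>x. g t x - g s x) = pair_norm (\<lambda>x. w s x - w t x) (\<lambda>x. g s x - g t x)"
        by (simp add: pair_norm_def power2_commute)
      have "pair_norm (\<lambda>x. w s x - w t x) (\<lambda>x. g s x - g t x) \<le> sobolev_norm k (\<lambda>z. w s z - w t z)"
        using sobolev_1_if_H1_pair(2)[OF d _ H1_pairD(4)[OF d]] sobolev_norm_mono[OF k, of "\<lambda>z. w s z - w t z"] by simp
      then show "norm (pair_norm (w s) (g s) - pair_norm (w t) (g t)) \<le> sobolev_norm k (\<lambda>z. w s z - w t z)"
        using pair_norm_triangle[OF d w[OF t]] pair_norm_triangle[OF d' w[OF s]] unfolding sym by simp
    qed
  qed
qed

text \<open>The energy has derivative \<open>E'\<close> at every time of [0, \<tau>], so its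
  increment is the gauge integral of \<open>E'\<close>. Off the null set where \<phi>_t = \<phi>^m u
  may fail, \<open>E'\<close> is zero, and this integral therefore vanishes.\<close>

lemma (in magma_energy) energy_conserved:
  assumes sol: "magma_solution n m k T \<phi>\<^sub>0 \<phi>" and k: "1 \<le> k" and \<tau>: "0 \<le> \<tau>" "ereal \<tau> < T"
    and w: "\<And>t. 0 \<le> t \<Longrightarrow> ereal t < T \<Longrightarrow> H1_pair (\<lambda>z. \<phi> t z - 1) (g t)"
    and small: "\<And>t z. t \<in> {0..\<tau>} \<Longrightarrow> \<bar>\<phi> t z - 1\<bar> \<le> 1/2"
  shows "energy (\<lambda>z. \<phi> \<tau> z - 1) (g \<tau>) = energy (\<lambda>z. \<phi> 0 z - 1) (g 0)"
proof -
  define I where "I = {t. 0 \<le> t \<and> ereal t < T}"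
  have sub: "{0..\<tau>} \<subseteq> I"
    using le_less_trans[OF _ \<tau>(2)] by (auto simp: I_def)
  have wI: "\<And>t. t \<in> I \<Longrightarrow> H1_pair (\<lambda>z. \<phi> t z - 1) (g t)" using w by (simp add: I_def)
  obtain u where u: "\<And>s. s \<in> I \<Longrightarrow> continuous_on UNIV (u s) \<and> elliptic_weak_solution n m (\<phi> s) (u s)"
    and int: "\<And>t z. t \<in> I \<Longrightarrow> ((\<lambda>s. \<phi> s z powr m * u s z) has_integral (\<phi> t z - \<phi>\<^sub>0 z)) {0..t}"
    using sol unfolding magma_solution_def Let_def I_def[symmetric] by blast
  have C1: "sobolev_C1_on k I (\<lambda>t z. \<phi> t z - 1)" and pos: "\<And>t z. t \<in> I \<Longrightarrow> 0 < \<phi> t z"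
    and cont: "\<And>t. t \<in> I \<Longrightarrow> continuous_on UNIV (\<phi> t)"
    using sol unfolding magma_solution_def Let_def I_def[symmetric] by blast+
  obtain \<omega> \<gamma> where \<omega>: "\<And>t. t \<in> I \<Longrightarrow> H1_pair (\<omega> t) (\<gamma> t)"
    and limI: "\<And>t. t \<in> I \<Longrightarrow> ((\<lambda>s. pair_norm (\<lambda>x. ((\<phi> s x - 1) - (\<phi> t x - 1)) / (s - t) - \<omega> t x)
        (\<lambda>x. (g s x - g t x) / (s - t) - \<gamma> t x)) \<longlongrightarrow> 0) (at t within I)"
    using sobolev_C1_H1_derivative[OF C1 k wI] by blast
  have lim: "((\<lambda>s. pair_norm (\<lambda>x. ((\<phi> s x - 1) - (\<phi> t x - 1)) / (s - t) - \<omega> t x)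
        (\<lambda>x. (g s x - g t x) / (s - t) - \<gamma> t x)) \<longlongrightarrow> 0) (at t within {0..\<tau>})" if "t \<in> {0..\<tau>}" for t
    using tendsto_within_subset[OF limI sub] that sub by blast
  \<comment> \<open>Difference quotients that converge in H^1 converge at each point, by the sup
    bound.\<close>
  have D: "((\<lambda>s. \<phi> s z) has_real_derivative \<omega> t z) (at t within {0..\<tau>})" if t: "t \<in> {0..\<tau>}" for t z
    unfolding has_field_derivative_iff
  proof (rule LIM_zero_cancel, rule Lim_null_comparison)
    show "((\<lambda>s. 2 * pair_norm (\<lambda>x. ((\<phi> s x - 1) - (\<phi> t x - 1)) / (s - t) - \<omega> t x)
        (\<lambda>x. (g s x - g t x) / (s - t) - \<gamma> t x)) \<longlongrightarrow> 0) (at t within {0..\<tau>})"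
      using tendsto_mult[OF tendsto_const lim[OF t], of 2] by simp
    show "\<forall>\<^sub>F s in at t within {0..\<tau>}. norm ((\<phi> s z - \<phi> t z) / (s - t) - \<omega> t z) \<le>
        2 * pair_norm (\<lambda>x. ((\<phi> s x - 1) - (\<phi> t x - 1)) / (s - t) - \<omega> t x) (\<lambda>x. (g s x - g t x) / (s - t) - \<gamma> t x)"
      unfolding eventually_at_filter
    proof (intro always_eventually allI impI)
      fix s assume "s \<in> {0..\<tau>}"
      then have s: "s \<in> I" "t \<in> I" using t sub by auto
      have d: "H1_pair (\<lambda>x. (\<phi> s x - 1) - (\<phi> t x - 1)) (\<lambda>x. g s x - g t x)"
        using H1_pair_linear[OF wI[OF s(1)] wI[OF s(2)], of 1 "-1"] by simp
      have q: "H1_pair (\<lambda>x. ((\<phi> s x - 1) - (\<phi> t x - 1)) / (s - t) - \<omega> t x) (\<lambda>x. (g s x - g t x) / (s - t) - \<gamma> t x)"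
        using H1_pair_linear[OF d \<omega>[OF s(2)], of "1 / (s - t)" "-1"] by simp
      show "norm ((\<phi> s z - \<phi> t z) / (s - t) - \<omega> t z) \<le>
        2 * pair_norm (\<lambda>x. ((\<phi> s x - 1) - (\<phi> t x - 1)) / (s - t) - \<omega> t x) (\<lambda>x. (g s x - g t x) / (s - t) - \<gamma> t x)"
        using H1_pair_sup_bound[OF q, of z] by simp
    qed
  qed
  define N where "N = {t \<in> {0..\<tau>}. \<exists>z. \<omega> t z \<noteq> \<phi> t z powr m * u t z}"
  have N: "negligible N"
    unfolding N_def
  proof (rule derivative_eq_integrand_ae[OF D])
    show "((\<lambda>s. \<phi> s z powr m * u s z) has_integral (\<phi> t z - \<phi>\<^sub>0 z)) {0..t}" if "t \<in> {0..\<tau>}" for t z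
      using that sub by (intro int) auto
    show "continuous_on UNIV (\<omega> t)" if "t \<in> {0..\<tau>}" for t
      using that sub by (intro H1_pairD(6)[OF \<omega>]) auto
    show "continuous_on UNIV (\<lambda>z. \<phi> t z powr m * u t z)" if "t \<in> {0..\<tau>}" for t
    proof -
      have "t \<in> I" using that sub by auto
      have "\<phi> t z \<noteq> 0" for z using pos[OF \<open>t \<in> I\<close>, of z] by simp
      then show ?thesis
        using u[OF \<open>t \<in> I\<close>] cont[OF \<open>t \<in> I\<close>] by (intro continuous_on_mult continuous_on_powr continuous_on_const) auto
    qed
  qed
  let ?w = "\<lambda>t z. \<phi> t z - 1"
  define E' where "E' t = energy_deriv (?w t) (g t) (\<omega> t) (\<gamma> t)" for t
  have "((\<lambda>s. energy (?w s) (g s)) has_real_derivative E' t) (at t within {0..\<tau>})" if t: "t \<in> {0..\<tau>}" for t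
    unfolding E'_def
  proof (rule energy_has_derivative[OF t _ _ _ lim[OF t]])
    show "H1_pair (?w s) (g s)" if "s \<in> {0..\<tau>}" for s using that sub by (intro wI) auto
    show "H1_pair (\<omega> t) (\<gamma> t)" using t sub by (intro \<omega>) auto
  qed (rule small)
  then have "(E' has_integral energy (?w \<tau>) (g \<tau>) - energy (?w 0) (g 0)) {0..\<tau>}"
    using \<tau>(1) by (intro fundamental_theorem_of_calculus) (auto simp: has_real_derivative_iff_has_vector_derivative)
  moreover have "(E' has_integral 0) {0..\<tau>}"
  proof (rule has_integral_spike[OF N _ has_integral_0])
    fix t assume "t \<in> {0..\<tau>} - N"
    then have t: "t \<in> {0..\<tau>}" "t \<in> I" and eq: "\<And>z. \<omega> t z = (1 + ?w t z) powr m * u t z"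
      using sub by (auto simp: N_def)
    show "E' t = 0"
      unfolding E'_def
      by (rule energy_deriv_eq_0[OF wI[OF t(2)] small[OF t(1)] _ _ \<omega>[OF t(2)] eq]) (use u[OF t(2)] in auto)
  qed
  ultimately have "energy (?w \<tau>) (g \<tau>) - energy (?w 0) (g 0) = 0"
    by (rule has_integral_unique)
  then show ?thesis by simp
qed

text \<open>The set where N equals \<epsilon> is compact and nonempty, and \<tau> is its least
  element. A larger value on [0, \<tau>] would, by the intermediate value theorem starting from N 0
  < \<epsilon>, force a smaller element or \<tau> itself to have that larger value.\<close>

lemma first_time_reaching:
  fixes N :: "real \<Rightarrow> real"
  assumes cont: "continuous_on {0..t} N" and "N 0 < \<epsilon>" "\<epsilon> < N t" "0 \<le> t"
  obtains \<tau> where "\<tau> \<in> {0..t}" "N \<tau> = \<epsilon>" "\<And>s. s \<in> {0..\<tau>} \<Longrightarrow> N s \<le> \<epsilon>"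
proof -
  define A where "A = {s \<in> {0..t}. N s = \<epsilon>}"
  have "closed A" unfolding A_def using cont by (intro continuous_closed_preimage_constant) auto
  moreover have bA: "A \<subseteq> {0..t}" by (auto simp: A_def)
  ultimately have "compact A" by (meson bounded_closed_interval bounded_subset compact_eq_bounded_closed)
  moreover have ivt: "\<exists>r. 0 \<le> r \<and> r \<le> s \<and> N r = \<epsilon>" if "s \<in> {0..t}" "\<epsilon> \<le> N s" for s
    using that assms by (intro IVT') (auto intro: continuous_on_subset)
  then have "A \<noteq> {}" using assms by (force simp: A_def)
  ultimately obtain \<tau> where \<tau>: "\<tau> \<in> A" "\<And>s. s \<in> A \<Longrightarrow> \<tau> \<le> s"
    using compact_attains_inf[of A] by blast
  have "N s \<le> \<epsilon>" if s: "s \<in> {0..\<tau>}" for s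
  proof (rule ccontr)
    assume "\<not> N s \<le> \<epsilon>"
    moreover have "s \<in> {0..t}" using s \<tau>(1) bA by auto
    ultimately obtain r where r: "0 \<le> r" "r \<le> s" "N r = \<epsilon>" using ivt[of s] by auto
    then have "r \<in> A" using \<open>s \<in> {0..t}\<close> by (auto simp: A_def)
    then have "\<tau> \<le> r" by (rule \<tau>(2))
    with r s have "r = s" by auto
    with r \<open>\<not> N s \<le> \<epsilon>\<close> show False by simp
  qed
  with \<tau>(1) that show ?thesis by (auto simp: A_def)
qed

theorem corollary4p7:
  fixes n m :: real
  shows "\<exists>\<epsilon>\<^sub>c>0. \<forall>\<epsilon>. 0 < \<epsilon> \<and> \<epsilon> < \<epsilon>\<^sub>c \<longrightarrow>
    (\<exists>\<delta>>0. \<forall>(\<phi>\<^sub>0 :: real \<Rightarrow> real) (\<phi> :: real \<Rightarrow> real \<Rightarrow> real) (k :: nat) (T :: ereal).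
       1 \<le> k \<and> 0 < T \<and>
       (\<lambda>z. \<phi>\<^sub>0 z - 1) \<in> sobolev 1 \<and> sobolev_norm 1 (\<lambda>z. \<phi>\<^sub>0 z - 1) \<le> \<delta> \<and>
       magma_solution n m k T \<phi>\<^sub>0 \<phi> \<longrightarrow>
       (\<forall>t. 0 \<le> t \<and> ereal t < T \<longrightarrow> sobolev_norm 1 (\<lambda>z. \<phi> t z - 1) \<le> \<epsilon>))"
proof -
  obtain c C where "magma_energy n m c C" using magma_energy_exists by blast
  then interpret magma_energy n m c C .
  have cC: "0 < c" "c \<le> C" using c_pos p_bounds[of 1] by auto
  show ?thesis
  \<comment> \<open>By the sup bound, a norm of at most \<epsilon> < 1/4 keeps \<phi> in [1/2, 3/2],
    where the energy bounds hold.\<close>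
  proof (rule exI[of _ "1/4"], intro conjI allI impI)
    fix \<epsilon> :: real assume \<epsilon>: "0 < \<epsilon> \<and> \<epsilon> < 1/4"
    \<comment> \<open>The contradiction with c \<epsilon>^2 \<le> C \<delta>^2 requires C \<delta>^2
      < c \<epsilon>^2; the factor 1/2 makes this strict, and \<delta> < \<epsilon> as well.\<close>
    define \<delta> where "\<delta> = \<epsilon> * sqrt (c / C) / 2"
    have \<delta>: "0 < \<delta>" using \<epsilon> cC by (simp add: \<delta>_def)
    have "sqrt (c / C) \<le> 1" using cC by simp
    then have "\<epsilon> * sqrt (c / C) \<le> \<epsilon> * 1" using \<epsilon> by (intro mult_left_mono) auto
    then have \<delta>\<epsilon>: "\<delta> < \<epsilon>" unfolding \<delta>_def using \<epsilon> by linarith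
    have "C * \<delta>\<^sup>2 = c * \<epsilon>\<^sup>2 / 4" using cC by (simp add: \<delta>_def power_mult_distrib power_divide)
    also have "\<dots> < c * \<epsilon>\<^sup>2" using cC \<epsilon> by simp
    finally have C\<delta>: "C * \<delta>\<^sup>2 < c * \<epsilon>\<^sup>2" .
    show "\<exists>\<delta>>0. \<forall>\<phi>\<^sub>0 \<phi> k T. 1 \<le> k \<and> 0 < T \<and>
       (\<lambda>z. \<phi>\<^sub>0 z - 1) \<in> sobolev 1 \<and> sobolev_norm 1 (\<lambda>z. \<phi>\<^sub>0 z - 1) \<le> \<delta> \<and>
       magma_solution n m k T \<phi>\<^sub>0 \<phi> \<longrightarrow>
       (\<forall>t. 0 \<le> t \<and> ereal t < T \<longrightarrow> sobolev_norm 1 (\<lambda>z. \<phi> t z - 1) \<le> \<epsilon>)"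
    proof (intro exI[of _ \<delta>] conjI \<delta> allI impI)
      fix \<phi>\<^sub>0 :: "real \<Rightarrow> real" and \<phi> :: "real \<Rightarrow> real \<Rightarrow> real" and k :: nat and T :: ereal and t :: real
      assume *: "1 \<le> k \<and> 0 < T \<and> (\<lambda>z. \<phi>\<^sub>0 z - 1) \<in> sobolev 1 \<and>
        sobolev_norm 1 (\<lambda>z. \<phi>\<^sub>0 z - 1) \<le> \<delta> \<and> magma_solution n m k T \<phi>\<^sub>0 \<phi>"
        and t: "0 \<le> t \<and> ereal t < T"
      define I where "I = {t. 0 \<le> t \<and> ereal t < T}"
      define g where "g t = weak_derivative 1 (\<lambda>z. \<phi> t z - 1)" for t
      define N where "N t = pair_norm (\<lambda>z. \<phi> t z - 1) (g t)" for t
      have k: "1 \<le> k" and sol: "magma_solution n m k T \<phi>\<^sub>0 \<phi>" using * by auto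
      have cont: "sobolev_continuous_on k I (\<lambda>t z. \<phi> t z - 1)" "\<And>t. t \<in> I \<Longrightarrow> continuous_on UNIV (\<phi> t)"
        using sol unfolding magma_solution_def Let_def I_def[symmetric] sobolev_C1_on_def by blast+
      have w: "H1_pair (\<lambda>z. \<phi> t z - 1) (g t)" if "t \<in> I" for t
        unfolding g_def
      proof (rule sobolev_1_continuous_imp_H1_pair)
        show "(\<lambda>z. \<phi> t z - 1) \<in> sobolev 1"
          using cont(1) that sobolev_mono[OF k] by (auto simp: sobolev_continuous_on_def)
        show "continuous_on UNIV (\<lambda>z. \<phi> t z - 1)" using cont(2)[OF that] by (intro continuous_intros)
      qed
      have N: "sobolev_norm 1 (\<lambda>z. \<phi> t z - 1) = N t" if "t \<in> I" for t
        unfolding N_def using sobolev_1_if_H1_pair(2)[OF w[OF that] _ H1_pairD(4)[OF w[OF that]]] by simp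
      have I: "0 \<in> I" "t \<in> I" "{0..t} \<subseteq> I"
        using * t le_less_trans[of "ereal _" "ereal t" T] unfolding I_def by (auto simp: zero_ereal_def)
      have "\<phi> 0 = \<phi>\<^sub>0"
      proof
        fix z
        obtain h :: "real \<Rightarrow> real" where "(h has_integral (\<phi> 0 z - \<phi>\<^sub>0 z)) {0..0}"
          using sol I(1) unfolding magma_solution_def Let_def I_def[symmetric] by blast
        moreover have "(h has_integral 0) {0..0}" using has_integral_refl(2)[of h 0] by simp
        ultimately have "\<phi> 0 z - \<phi>\<^sub>0 z = 0" by (rule has_integral_unique)
        then show "\<phi> 0 z = \<phi>\<^sub>0 z" by simp
      qed
      then have N0: "N 0 \<le> \<delta>" using N[OF I(1)] * by simp
      have contN: "continuous_on I N"
        unfolding N_def[abs_def] by (rule pair_norm_continuous[OF cont(1) k w])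
      have "N t \<le> \<epsilon>"
      proof (rule ccontr)
        assume "\<not> N t \<le> \<epsilon>"
        then obtain \<tau> where \<tau>: "\<tau> \<in> {0..t}" "N \<tau> = \<epsilon>" "\<And>s. s \<in> {0..\<tau>} \<Longrightarrow> N s \<le> \<epsilon>"
          using first_time_reaching[of t N \<epsilon>] continuous_on_subset[OF contN I(3)] N0 \<delta>\<epsilon> t by (metis le_less_trans not_le)
        have sub: "s \<in> I" if "s \<in> {0..\<tau>}" for s using that \<tau>(1) I(3) by auto
        have small: "\<bar>\<phi> s z - 1\<bar> \<le> 1/2" if "s \<in> {0..\<tau>}" for s z
          using H1_pair_sup_bound[OF w[OF sub[OF that]], of z] \<tau>(3)[OF that] \<epsilon> unfolding N_def by linarith
        have \<tau>I: "0 \<le> \<tau>" "ereal \<tau> < T" "\<tau> \<in> I" using \<tau>(1) sub[of \<tau>] by (auto simp: I_def)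
        have "c * \<epsilon>\<^sup>2 \<le> energy (\<lambda>z. \<phi> \<tau> z - 1) (g \<tau>)"
          using energy_bounds(1)[OF w[OF \<tau>I(3)]] small[of \<tau>] \<tau>(2) \<tau>I(1) by (simp add: N_def)
        also have "\<dots> = energy (\<lambda>z. \<phi> 0 z - 1) (g 0)"
          by (rule energy_conserved[OF sol k \<tau>I(1,2) w small]) (auto simp: I_def)
        also have "\<dots> \<le> C * (N 0)\<^sup>2"
          using energy_bounds(2)[OF w[OF I(1)]] small[of 0] \<tau>I(1) by (simp add: N_def)
        also have "\<dots> \<le> C * \<delta>\<^sup>2"
          using N0 cC by (intro mult_left_mono power_mono) (auto simp: N_def pair_norm_nonneg)
        finally show False using C\<delta> by simp
      qed
      with N[OF I(2)] show "sobolev_norm 1 (\<lambda>z. \<phi> t z - 1) \<le> \<epsilon>" by simp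
    qed
  qed simp
qed

end
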